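(* Let $n=2$, $B=B^2(0,1/4)$, $I=[1,2]$, $\alpha\in(0,2]$ and $p,q,s\in[1,\infty]$ (with $1/\infty=0$). Suppose that at least one of the following holds: (i) there is a constant $C$ such that $\|\mathcal{A}f\|_{L^q_x(B,\nu)(L^s_r(I))}\le C\langle\nu\rangle_\alpha^{1/q}\|f\|_{L^p(\mathbb{R}^2)}$ for all $f\in L^p(\mathbb{R}^2)$ and all $\nu\in\mathfrak{C}^2(\alpha)$; (ii) for every $\varepsilon>0$ there is a constant $C_\varepsilon$ such that $\|\mathcal{A}_\delta f\|_{L^q_x(B,\nu)(L^s_r(I))}\le C_\varepsilon\delta^{-\varepsilon}\langle\nu\rangle_\alpha^{1/q}\|f\|_{L^p(\mathbb{R}^2)}$ for all $0<\delta<1$, all $f\in L^p(\mathbb{R}^2)$ and all $\nu\in\mathfrak{C}^2(\alpha)$. Then $$\frac1s+\frac{\alpha}{q}\ge\frac1p,\qquad 1+\frac2s+\frac{\max\{0,\alpha-1\}}{q}\ge\frac3p,\qquad 1+\frac1s\ge\frac2p;$$ moreover, if $\alpha\in[1,2]$ then $1+\frac2s\ge\frac{4-\alpha}{p}$, and if $\alpha\in(0,1]$ then $\frac1s\ge\frac{1-\alpha}{p}$.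
   Context: Circular averages: $\mathcal{A}f(x,r)=\int_{\mathbb{S}^1}f(x-ry)\,d\sigma(y)$ for $x\in\mathbb{R}^2$, $r>0$, where $\sigma$ is the normalized arc-length measure on $\mathbb{S}^1$. For $0<\delta<1$ and $r\in[1,2]$, let $S_\delta(x,r)=\{y\in\mathbb{R}^2:\ ||y-x|-r|\le\delta\}$ and $\mathcal{A}_\delta f(x,r)=\frac{1}{\mathcal{L}^2(S_\delta(x,r))}\int_{S_\delta(x,r)}f(y)\,dy$. For $\alpha\in(0,d]$, $\mathfrak{C}^d(\alpha)$ is the class of nonnegative Borel measures $\mu$ on $\mathbb{R}^d$ with $\langle\mu\rangle_\alpha:=\sup_{x\in\mathbb{R}^d,\,\rho\in(0,1]}\mu(B^d(x,\rho))\rho^{-\alpha}<\infty$, where $B^d(x,\rho)$ is the closed ball. Mixed norm: $\|F\|_{L^q_x(\Omega,\nu)(L^s_r(I))}=\big(\int_\Omega(\int_I|F(x,r)|^s\,dr)^{q/s}\,d\nu(x)\big)^{1/q}$, with the usual modification when $q$ or $s$ is $\infty$. *)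

theory Defs
  imports "HOL-Analysis.Analysis" "HOL-Probability.Essential_Supremum"
begin

text \<open>
  Powers of extended nonnegative reals, used for exponents \<open>a \<ge> 0\<close>. The convention \<open>x\<^sup>0 = 1\<close>
  (also for \<open>x = 0\<close> and \<open>x = \<infinity>\<close>) differs from \<^const>\<open>powr\<close>, where \<open>0 powr 0 = 0\<close>.
\<close>

definition epowr :: "ennreal \<Rightarrow> real \<Rightarrow> ennreal" where
  "epowr x a = (if a = 0 then 1 else if x = \<infinity> then \<infinity> else ennreal (enn2real x powr a))"

text \<open>
  The norm is taken for \<^typ>\<open>ennreal\<close>-valued functions so that it can be iterated. Exponents range
  over \<^typ>\<open>ennreal\<close>; they are meant to satisfy \<open>1 \<le> p\<close>.
\<close>

definition Lp_norm :: "ennreal \<Rightarrow> 'a measure \<Rightarrow> ('a \<Rightarrow> ennreal) \<Rightarrow> ennreal" where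
  "Lp_norm p M g =
     (if p = \<infinity> then esssup M g
      else epowr (\<integral>\<^sup>+ x. epowr (g x) (enn2real p) \<partial>M) (1 / enn2real p))"

text \<open>
  Elements of \<open>L\<^sup>p(\<real>\<^sup>d)\<close> are represented by Borel functions; every class modulo Lebesgue null sets
  has such a representative.
\<close>

definition Lp_space :: "ennreal \<Rightarrow> ('a::euclidean_space \<Rightarrow> complex) set" where
  "Lp_space p = {f \<in> borel_measurable borel. Lp_norm p lborel (\<lambda>x. ennreal (norm (f x))) < \<infinity>}"

text \<open>\<open>mixed_norm q \<Omega> \<nu> s I F\<close> is \<open>\<parallel>F\<parallel>\<close> in \<open>L\<^sup>q\<^sub>x(\<Omega>, \<nu>)(L\<^sup>s\<^sub>r(I))\<close>.\<close>

definition mixed_norm ::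
  "ennreal \<Rightarrow> 'a set \<Rightarrow> 'a measure \<Rightarrow> ennreal \<Rightarrow> real set \<Rightarrow> ('a \<Rightarrow> real \<Rightarrow> complex) \<Rightarrow> ennreal" where
  "mixed_norm q \<Omega> \<nu> s I F =
     Lp_norm q (restrict_space \<nu> \<Omega>)
       (\<lambda>x. Lp_norm s (restrict_space lborel I) (\<lambda>r. ennreal (norm (F x r))))"

definition frostman_const :: "real \<Rightarrow> 'a::euclidean_space measure \<Rightarrow> ennreal" where
  "frostman_const \<alpha> \<mu> =
     (SUP (x, \<rho>) \<in> UNIV \<times> {0<..1}. emeasure \<mu> (cball x \<rho>) * ennreal (\<rho> powr (- \<alpha>)))"

definition frostman_class :: "real \<Rightarrow> 'a::euclidean_space measure set" where
  "frostman_class \<alpha> = {\<mu>. sets \<mu> = sets borel \<and> frostman_const \<alpha> \<mu> < \<infinity>}"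

text \<open>
  Normalized arc length on the unit circle, as a Borel measure on the plane: the image of the
  uniform distribution on \<open>[0, 2\<pi>)\<close> under the arc-length parametrization.
\<close>

definition circle_measure :: "(real^2) measure" where
  "circle_measure =
     distr (uniform_measure lborel {0..<2 * pi}) borel (\<lambda>\<theta>. vector [cos \<theta>, sin \<theta>])"

text \<open>
  For \<open>f \<in> L\<^sup>p\<close> and any fixed \<open>x\<close>, polar coordinates around \<open>x\<close> show that the integral converges
  for almost every \<open>r > 0\<close>, and that it depends, up to a null set of \<open>r\<close>, only on the class of
  \<open>f\<close>. At the exceptional \<open>r\<close> the Bochner integral has value \<open>0\<close>; this does not affect the mixed
  norms.
\<close>

definition circ_avg :: "(real^2 \<Rightarrow> complex) \<Rightarrow> real^2 \<Rightarrow> real \<Rightarrow> complex" where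
  "circ_avg f x r = (LINT y|circle_measure. f (x - r *\<^sub>R y))"

definition annulus :: "real \<Rightarrow> real^2 \<Rightarrow> real \<Rightarrow> (real^2) set" where
  "annulus \<delta> x r = {y. \<bar>norm (y - x) - r\<bar> \<le> \<delta>}"

definition annulus_avg :: "real \<Rightarrow> (real^2 \<Rightarrow> complex) \<Rightarrow> real^2 \<Rightarrow> real \<Rightarrow> complex" where
  "annulus_avg \<delta> f x r =
     (1 / measure lborel (annulus \<delta> x r)) *\<^sub>R (LINT y:annulus \<delta> x r|lborel. f y)"

end

theory Submission
  imports Defs "HOL-Probability.Probability_Measure"
begin

text \<open>
  The estimate is tested on \<open>f = 1\<^sub>F\<close> against a measure \<open>\<nu>\<close> that is a multiple of Lebesgue measure on
  a set \<open>E\<close>: if both \<open>\<A> f\<close> and \<open>\<A>\<^sub>\<delta> f\<close> are at least \<open>v\<close> for \<open>x \<in> E\<close> and \<open>r\<close> in an interval of length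
  about \<open>\<delta>\<close>, then \<open>v \<delta>\<^bsup>1/s\<^esup> \<nu>(E)\<^bsup>1/q\<^esup>\<close> is bounded by a multiple of \<open>\<delta>\<^bsup>-\<epsilon>\<^esup> |F|\<^bsup>1/p\<^esup>\<close>, and letting
  \<open>\<delta> \<rightarrow> 0\<close> compares exponents. The set \<open>E\<close> is a union of about \<open>w\<^bsup>-\<gamma>\<^esup>\<close> equally spaced rectangles
  of size about \<open>L \<times> w\<close>. With \<open>L = w = \<delta>\<close>, let \<open>F\<close> be a union of \<open>\<delta>\<close>-annuli of radius \<open>3/2\<close>, one
  around each square; then \<open>\<gamma> = 0\<close> and \<open>\<gamma> = \<alpha>\<close> give the first and the last condition. With \<open>L = 1\<close> and
  \<open>w = \<surd>\<delta>\<close>, let \<open>F\<close> be a union of \<open>\<delta> \<times> \<surd>\<delta>\<close> Knapp rectangles, one facing each strip; then \<open>\<gamma> = 0\<close>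
  and \<open>\<gamma> = \<alpha> - 1\<close> give the second and the fourth condition. The third comes from a \<open>\<delta>\<close>-ball \<open>F\<close> and
  an \<open>E\<close> of unit size.
\<close>

subsection \<open>Norms of functions with large level sets\<close>

lemma enn2real_inverse_exponent:
  assumes "1 \<le> p" "p \<noteq> \<infinity>"
  shows "1 \<le> enn2real p" "enn2real (1 / p) = 1 / enn2real p"
proof -
  have "p < top" using assms(2) by (simp add: top.not_eq_extremum)
  then show "1 \<le> enn2real p" using assms(1) enn2real_mono[of 1 p] by simp
  have "p = ennreal (enn2real p)" using \<open>p < top\<close> by simp
  then have "1 / p = ennreal 1 / ennreal (enn2real p)" by simp
  also have "\<dots> = ennreal (1 / enn2real p)"
    using \<open>1 \<le> enn2real p\<close> by (intro divide_ennreal) auto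
  finally show "enn2real (1 / p) = 1 / enn2real p" by simp
qed

lemma epowr_ennreal: "0 \<le> y \<Longrightarrow> a \<noteq> 0 \<Longrightarrow> epowr (ennreal y) a = ennreal (y powr a)"
  by (simp add: epowr_def)

lemma epowr_mono: "x \<le> y \<Longrightarrow> 0 \<le> a \<Longrightarrow> epowr x a \<le> epowr y a"
  by (auto simp: epowr_def top_unique less_top intro!: ennreal_leI powr_mono2 enn2real_mono)

text \<open>Chebyshev's inequality. Since \<open>c\<close> is positive, \<open>c powr 0 = 1\<close>,
  so one formula also covers an infinite \<open>p\<close>, where 1/p = 0; in that case a
  non-measurable \<open>g\<close> has essential supremum infinity.\<close>

lemma Lp_norm_ge_level:
  assumes p: "1 \<le> p" and A: "A \<in> sets M" and c: "0 < c" "ennreal c \<le> emeasure M A"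
    and v: "0 \<le> v" and ge: "\<And>x. x \<in> A \<Longrightarrow> ennreal v \<le> g x"
  shows "ennreal (v * c powr enn2real (1 / p)) \<le> Lp_norm p M g"
proof (cases "p = \<infinity>")
  case True
  have "ennreal v \<le> esssup M g"
  proof (cases "g \<in> borel_measurable M")
    case True
    \<comment> \<open>Otherwise \<open>g\<close> would exceed its essential supremum on all of
      \<open>A\<close>, a set of positive measure.\<close>
    have "\<exists>x\<in>A. g x \<le> esssup M g"
    proof (rule ccontr)
      assume "\<not> ?thesis"
      then have "AE x in M. x \<notin> A"
        using esssup_AE[where M = M and f = g] by (auto elim: eventually_mono)
      then have "emeasure M A = 0"
        using A by (auto simp flip: AE_iff_null_sets)
      then show False using c by simp
    qed
    then show ?thesis using ge order_trans by blast
  qed (simp add: esssup_non_measurable)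
  then show ?thesis using True c by (simp add: Lp_norm_def)
next
  case False
  define P where "P = enn2real p"
  have P: "1 \<le> P" "enn2real (1 / p) = 1 / P"
    using enn2real_inverse_exponent[OF p False] by (auto simp: P_def)
  have "ennreal (v powr P * c) \<le> ennreal (v powr P) * emeasure M A"
    using c by (simp add: ennreal_mult mult_left_mono)
  also have "\<dots> = (\<integral>\<^sup>+ x. ennreal (v powr P) * indicator A x \<partial>M)"
    using A by (simp add: nn_integral_cmult_indicator)
  also have "\<dots> \<le> (\<integral>\<^sup>+ x. epowr (g x) P \<partial>M)"
  proof (rule nn_integral_mono)
    fix x
    show "ennreal (v powr P) * indicator A x \<le> epowr (g x) P"
      using epowr_mono[OF ge, of x P] P v by (auto simp: indicator_def epowr_ennreal)
  qed
  finally have "epowr (ennreal (v powr P * c)) (1 / P) \<le> Lp_norm p M g"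
    using False P by (auto simp: Lp_norm_def P_def[symmetric] intro: epowr_mono)
  moreover have "(v powr P * c) powr (1 / P) = v * c powr (1 / P)"
    using P v c by (simp add: powr_mult powr_powr)
  ultimately show ?thesis using P c by (simp add: epowr_ennreal)
qed

text \<open>For finite \<open>p\<close> the norm is |F|^(1/p). Positivity of \<open>m\<close> gives
  \<open>m powr 0 = 1\<close>, which is the right bound for the essential supremum of an
  indicator.\<close>

lemma Lp_norm_indicator_le:
  fixes F :: "'a::euclidean_space set"
  assumes p: "1 \<le> p" and F: "F \<in> sets borel" and m: "0 < m" "emeasure lborel F \<le> ennreal m"
  shows "Lp_norm p lborel (\<lambda>x. ennreal (norm (complex_of_real (indicator F x))))
           \<le> ennreal (m powr enn2real (1 / p))"
proof -
  have eq: "(\<lambda>x. ennreal (norm (complex_of_real (indicator F x))))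
              = (indicator F :: 'a \<Rightarrow> ennreal)"
    by (auto simp: indicator_def)
  show ?thesis
  proof (cases "p = \<infinity>")
    case True
    have "esssup lborel (indicator F :: 'a \<Rightarrow> ennreal) \<le> 1"
      using F by (intro esssup_I) (auto simp: indicator_def)
    then show ?thesis unfolding eq using True m by (simp add: Lp_norm_def)
  next
    case False
    note P = enn2real_inverse_exponent[OF p False]
    have "(\<lambda>x. epowr (indicator F x) (enn2real p)) = (indicator F :: 'a \<Rightarrow> ennreal)"
      using P by (auto simp: indicator_def epowr_def)
    then have "Lp_norm p lborel (indicator F) = epowr (emeasure lborel F) (1 / enn2real p)"
      using False F by (simp add: Lp_norm_def)
    also have "\<dots> \<le> epowr (ennreal m) (1 / enn2real p)"
      using m P by (intro epowr_mono) auto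
    also have "\<dots> = ennreal (m powr enn2real (1 / p))"
      using m P by (subst epowr_ennreal) auto
    finally show ?thesis unfolding eq .
  qed
qed

lemma indicator_in_Lp_space:
  fixes F :: "'a::euclidean_space set"
  assumes "1 \<le> p" "F \<in> sets borel" "0 < m" "emeasure lborel F \<le> ennreal m"
  shows "(\<lambda>x. complex_of_real (indicator F x)) \<in> Lp_space p"
  using Lp_norm_indicator_le[OF assms] assms(2)
  by (auto simp: Lp_space_def intro: order.strict_trans1)

text \<open>Dividing by \<open>t powr x\<close> leaves \<open>c \<le> C * t powr (y - x)\<close>,
  whose right side tends to 0 if \<open>y > x\<close>. All constants thus drop out of the
  comparison.\<close>

lemma powr_exponents_le:
  assumes c: "0 < c" and t0: "0 < t0"
    and le: "\<And>t. 0 < t \<Longrightarrow> t < t0 \<Longrightarrow> c * t powr x \<le> C * t powr y"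
  shows "y \<le> (x::real)"
proof (rule ccontr)
  assume "\<not> y \<le> x"
  then have lim: "((\<lambda>t. C * t powr (y - x)) \<longlongrightarrow> C * 0 powr (y - x)) (at_right 0)"
    by (intro tendsto_mult tendsto_const tendsto_powr') (auto intro!: eventually_at_rightI[of 0 1])
  have "eventually (\<lambda>t. c \<le> C * t powr (y - x)) (at_right 0)"
  proof (rule eventually_at_rightI[OF _ t0])
    fix t assume "t \<in> {0<..<t0}"
    then have "c * t powr x * t powr (- x) \<le> C * t powr y * t powr (- x)"
      using le by (intro mult_right_mono) auto
    then show "c \<le> C * t powr (y - x)"
      using \<open>t \<in> _\<close> by (simp add: mult.assoc flip: powr_add)
  qed
  then have "c \<le> C * 0 powr (y - x)"
    by (intro tendsto_lowerbound[OF lim]) auto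
  then show False using c \<open>\<not> y \<le> x\<close> by simp
qed

subsection \<open>Averages of indicator functions in the plane\<close>

lemma measurable_unit_circle [measurable]:
  "(\<lambda>\<theta>. vector [cos \<theta>, sin \<theta>] :: real^2) \<in> borel_measurable borel"
proof -
  have eq: "(\<lambda>\<theta>::real. vector [cos \<theta>, sin \<theta>] :: real^2) = (\<lambda>\<theta>. \<chi> i. if i = 1 then cos \<theta> else sin \<theta>)"
    by (auto simp: vec_eq_iff forall_2)
  have "continuous_on UNIV (\<lambda>\<theta>::real. if i = 1 then cos \<theta> else sin \<theta> :: real)" for i :: 2
    by (cases "i = 1")
       (simp_all add: continuous_on_cos[OF continuous_on_id] continuous_on_sin[OF continuous_on_id])
  then have "continuous_on UNIV (\<lambda>\<theta>::real. (\<chi> i. if i = 1 then cos \<theta> else sin \<theta>) :: real^2)"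
    by (rule continuous_on_vec_lambda)
  then show ?thesis
    unfolding eq by (rule borel_measurable_continuous_onI)
qed

text \<open>The average is the \<open>circle_measure\<close> of the preimage of \<open>F\<close>
  under y -> x - r y, which contains an arc of angle \<open>h\<close>. The strict bound on
  \<open>\<phi> + h\<close> keeps the closed parameter interval inside
  \<open>{0..<2 * pi}\<close>.\<close>

lemma circ_avg_indicator_ge:
  assumes F: "F \<in> sets borel" and \<phi>: "0 \<le> \<phi>" "0 \<le> h" "\<phi> + h < 2 * pi"
    and arc: "\<And>\<theta>. \<phi> \<le> \<theta> \<Longrightarrow> \<theta> \<le> \<phi> + h \<Longrightarrow> x - r *\<^sub>R vector [cos \<theta>, sin \<theta>] \<in> F"
  shows "h / (2 * pi) \<le> norm (circ_avg (\<lambda>y. complex_of_real (indicator F y)) x r)"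
proof -
  define A where "A = {y. x - r *\<^sub>R y \<in> F}"
  define U where "U = uniform_measure lborel {0..<2 * pi}"
  have [measurable]: "F \<in> sets borel" by (rule F)
  have A: "A \<in> sets borel" unfolding A_def by measurable
  have arcs: "{\<phi>..\<phi> + h} \<subseteq> (\<lambda>\<theta>. vector [cos \<theta>, sin \<theta>]) -` A"
    using arc by (auto simp: A_def)
  interpret U: prob_space U
    unfolding U_def by (rule prob_space_uniform_measure) auto
  have vimage: "(\<lambda>\<theta>. vector [cos \<theta>, sin \<theta>]) -` A \<in> sets borel"
    using measurable_sets_borel[OF measurable_unit_circle A] .
  have "h / (2 * pi) = measure U {\<phi>..\<phi> + h}"
    using \<phi> by (simp add: U_def measure_uniform_measure Int_absorb1 subset_eq)
  also have "\<dots> \<le> measure U ((\<lambda>\<theta>. vector [cos \<theta>, sin \<theta>]) -` A)"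
    using arcs vimage by (intro U.finite_measure_mono) (auto simp: U_def)
  also have "\<dots> = measure circle_measure A"
    using A by (simp add: circle_measure_def measure_distr U_def)
  also have "\<dots> = (LINT y|circle_measure. indicator A y)"
    by (simp add: circle_measure_def)
  also have "(LINT y|circle_measure. indicator A y) = (LINT y|circle_measure. indicator F (x - r *\<^sub>R y))"
    by (intro Bochner_Integration.integral_cong) (auto simp: A_def indicator_def)
  finally show ?thesis
    by (simp add: circ_avg_def)
qed

section \<open>Areas of annuli and rectangles, and averages over annuli\<close>

lemma annulus_eq_cball_diff: "annulus \<delta> x r = cball x (r + \<delta>) - ball x (r - \<delta>)"
  by (auto simp: annulus_def dist_norm norm_minus_commute)

lemma annulus_borel [measurable]: "annulus \<delta> x r \<in> sets borel"
  by (simp add: annulus_eq_cball_diff)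

lemma emeasure_annulus:
  assumes "0 \<le> \<delta>" "\<delta> \<le> r"
  shows "emeasure lborel (annulus \<delta> x r) = ennreal (4 * pi * r * \<delta>)"
proof -
  have "emeasure lborel (annulus \<delta> x r)
      = emeasure lborel (cball x (r + \<delta>)) - emeasure lborel (ball x (r - \<delta>))"
    unfolding annulus_eq_cball_diff using assms emeasure_lborel_ball_finite[of x "r - \<delta>"]
    by (intro emeasure_Diff) (auto simp: dist_norm)
  also have "\<dots> = ennreal (pi * (r + \<delta>)\<^sup>2 - pi * (r - \<delta>)\<^sup>2)"
    using assms by (simp add: emeasure_cball emeasure_ball unit_ball_vol_2 ennreal_minus)
  also have "pi * (r + \<delta>)\<^sup>2 - pi * (r - \<delta>)\<^sup>2 = 4 * pi * r * \<delta>"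
    by (simp add: power2_eq_square algebra_simps)
  finally show ?thesis .
qed

text \<open>\<open>G\<close> is a piece of \<open>F\<close> whose area is easy to compute. The
  annulus has area 4 pi r \<delta>, at most 8 pi \<delta> because \<open>r \<le> 2\<close>.\<close>

lemma annulus_avg_indicator_ge:
  assumes F: "F \<in> sets borel" and G: "G \<in> sets borel" "G \<subseteq> F" "G \<subseteq> annulus \<delta> x r"
    and r: "0 < \<delta>" "\<delta> \<le> r" "r \<le> 2"
  shows "measure lborel G / (8 * pi * \<delta>)
           \<le> norm (annulus_avg \<delta> (\<lambda>y. complex_of_real (indicator F y)) x r)"
proof -
  let ?A = "annulus \<delta> x r"
  have meas: "measure lborel ?A = 4 * pi * r * \<delta>"
    using emeasure_annulus[of \<delta> r x] r by (simp add: measure_def)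
  \<comment> \<open>\<open>F\<close> may have infinite area, and monotonicity of the real-valued
    \<open>measure\<close> requires the larger set to have finite measure.\<close>
  have fin: "emeasure lborel (F \<inter> ?A) \<noteq> \<infinity>"
    using emeasure_annulus[of \<delta> r x] r F
      emeasure_mono[of "F \<inter> ?A" ?A lborel] by (auto simp: top_unique)
  have "(LINT y:?A|lborel. complex_of_real (indicator F y))
      = (LINT y|lborel. complex_of_real (indicator (F \<inter> ?A) y))"
    unfolding set_lebesgue_integral_def
    by (intro Bochner_Integration.integral_cong) (auto simp: indicator_def)
  also have "\<dots> = complex_of_real (measure lborel (F \<inter> ?A))"
    by (subst integral_complex_of_real) simp
  finally have avg: "norm (annulus_avg \<delta> (\<lambda>y. complex_of_real (indicator F y)) x r)
      = measure lborel (F \<inter> ?A) / (4 * pi * r * \<delta>)"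
    using r by (simp add: annulus_avg_def meas norm_divide)
  have "measure lborel G / (8 * pi * \<delta>) \<le> measure lborel (F \<inter> ?A) / (4 * pi * r * \<delta>)"
  proof (rule frac_le)
    show "measure lborel G \<le> measure lborel (F \<inter> ?A)"
      using F G fin by (intro measure_mono_fmeasurable) (auto simp: fmeasurable_def top.not_eq_extremum)
  qed (use r in auto)
  then show ?thesis using avg by simp
qed

text \<open>Made for rectangles cut off by \<open>min\<close> and \<open>max\<close>, which may be
  empty; nonnegative bounds \<open>A\<close> and \<open>C\<close> remain valid there, although the
  signed side lengths may be negative.\<close>

lemma emeasure_cbox_plane_le:
  fixes l u :: "real^2"
  assumes "u $ 1 - l $ 1 \<le> A" "u $ 2 - l $ 2 \<le> C" "0 \<le> A" "0 \<le> C"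
  shows "emeasure lborel (cbox l u) \<le> ennreal (A * C)"
proof (cases "cbox l u = {}")
  case False
  then have le: "l $ 1 \<le> u $ 1" "l $ 2 \<le> u $ 2"
    by (auto simp: interval_ne_empty_cart)
  have "emeasure lborel (cbox l u) = ennreal (measure lborel (cbox l u))"
    using emeasure_lborel_cbox_finite[of l u] by (simp add: emeasure_eq_ennreal_measure)
  also have "measure lborel (cbox l u) = (u $ 1 - l $ 1) * (u $ 2 - l $ 2)"
    using False by (simp add: content_cbox_cart UNIV_2)
  also have "\<dots> \<le> A * C"
    using assms le by (intro mult_mono) auto
  finally show ?thesis by (simp add: ennreal_leI)
qed simp

lemma measure_cbox_plane:
  fixes l u :: "real^2"
  assumes "l $ 1 \<le> u $ 1" "l $ 2 \<le> u $ 2"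
  shows "measure lborel (cbox l u) = (u $ 1 - l $ 1) * (u $ 2 - l $ 2)"
  using assms by (subst content_cbox_cart) (auto simp: interval_ne_empty_cart forall_2 UNIV_2)

lemma emeasure_box_plane:
  fixes l u :: "real^2"
  assumes "l $ 1 \<le> u $ 1" "l $ 2 \<le> u $ 2"
  shows "emeasure lborel (box l u) = ennreal ((u $ 1 - l $ 1) * (u $ 2 - l $ 2))"
proof -
  have le: "\<forall>b\<in>Basis. l \<bullet> b \<le> u \<bullet> b"
    using assms by (auto simp: Basis_vec_def inner_axis forall_2 exhaust_2)
  have "emeasure lborel (box l u) = emeasure lborel (cbox l u)"
    using le by (simp add: emeasure_lborel_box_eq emeasure_lborel_cbox_eq)
  also have "\<dots> = ennreal (measure lborel (cbox l u))"
    using emeasure_lborel_cbox_finite[of l u] by (simp add: emeasure_eq_ennreal_measure)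
  finally show ?thesis by (simp only: measure_cbox_plane[OF assms])
qed

text \<open>Used to count the teeth that can meet a ball. The extra 1 occurs when both end points
  are integers.\<close>

lemma card_nat_interval_le:
  fixes A l :: real and N :: nat
  assumes "0 \<le> l"
  shows "real (card {i. i < N \<and> A \<le> real i \<and> real i \<le> A + l}) \<le> l + 1"
proof -
  have "card {i. i < N \<and> A \<le> real i \<and> real i \<le> A + l} \<le> card {\<lceil>A\<rceil>..\<lfloor>A + l\<rfloor>}"
    by (rule card_inj_on_le[where f = int])
       (auto simp: inj_on_def ceiling_le_iff le_floor_iff)
  also have "real \<dots> \<le> l + 1"
    using assms by (simp add: nat_le_iff) linarith
  finally show ?thesis by simp
qed

subsection \<open>Frostman measures on unions of equally spaced rectangles\<close>

text \<open>The factor 1/8 keeps all teeth in a square of side 1/8. Open boxes make neighbouring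
  teeth disjoint even for \<open>w = \<tau>\<close>.\<close>

definition tooth :: "real \<Rightarrow> real \<Rightarrow> real \<Rightarrow> nat \<Rightarrow> (real^2) set" where
  "tooth L w \<tau> i = box (vector [0, real i * \<tau> / 8]) (vector [L / 8, (real i * \<tau> + w) / 8])"

definition teeth :: "real \<Rightarrow> nat" where
  "teeth \<tau> = nat \<lfloor>1 / \<tau>\<rfloor>"

definition comb :: "real \<Rightarrow> real \<Rightarrow> real \<Rightarrow> (real^2) set" where
  "comb L w \<tau> = (\<Union>i<teeth \<tau>. tooth L w \<tau> i)"

text \<open>With height \<open>\<kappa> = w powr (a - 1) * L powr (b - 1)\<close>, each tooth has
  mass w^a L^b / 64.\<close>

definition comb_measure :: "real \<Rightarrow> real \<Rightarrow> real \<Rightarrow> real \<Rightarrow> (real^2) measure" where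
  "comb_measure \<kappa> L w \<tau> = density lborel (\<lambda>x. ennreal \<kappa> * indicator (comb L w \<tau>) x)"

lemma mem_tooth_iff:
  "x \<in> tooth L w \<tau> i \<longleftrightarrow> 0 < x $ 1 \<and> x $ 1 < L / 8 \<and>
     real i * \<tau> / 8 < x $ 2 \<and> x $ 2 < (real i * \<tau> + w) / 8"
  by (auto simp: tooth_def mem_box_cart forall_2)

text \<open>With n = \<open>teeth \<tau>\<close>, the floor of 1/\<tau> is at least 1, so 1/\<tau> <
  n + 1 \<le> 2 n.\<close>

lemma teeth_bounds:
  assumes "0 < \<tau>" "\<tau> \<le> 1"
  shows "real (teeth \<tau>) \<le> 1 / \<tau>" "1 / (2 * \<tau>) \<le> real (teeth \<tau>)"
proof -
  have ge1: "1 \<le> 1 / \<tau>" using assms by simp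
  then have "1 \<le> \<lfloor>1 / \<tau>\<rfloor>" by (simp only: le_floor_iff of_int_1)
  then have "0 \<le> \<lfloor>1 / \<tau>\<rfloor>" by linarith
  then have r: "real (teeth \<tau>) = of_int \<lfloor>1 / \<tau>\<rfloor>"
    unfolding teeth_def by (rule of_nat_nat)
  have "1 \<le> teeth \<tau>" using \<open>1 \<le> \<lfloor>1 / \<tau>\<rfloor>\<close> unfolding teeth_def by linarith
  then have "1 \<le> real (teeth \<tau>)" by simp
  show "real (teeth \<tau>) \<le> 1 / \<tau>" using r by simp
  have "1 / \<tau> < real (teeth \<tau>) + 1" using r by linarith
  then have "1 / \<tau> \<le> 2 * real (teeth \<tau>)" using \<open>1 \<le> real (teeth \<tau>)\<close> by linarith
  then show "1 / (2 * \<tau>) \<le> real (teeth \<tau>)" by simp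
qed

lemma tooth_borel [measurable, simp]: "tooth L w \<tau> i \<in> sets borel"
  by (simp add: tooth_def)

lemma comb_borel [measurable, simp]: "comb L w \<tau> \<in> sets borel"
  by (simp add: comb_def)

lemma sets_comb_measure [simp]: "sets (comb_measure \<kappa> L w \<tau>) = sets borel"
  by (simp add: comb_measure_def)

lemma emeasure_comb_measure:
  assumes "A \<in> sets borel"
  shows "emeasure (comb_measure \<kappa> L w \<tau>) A = ennreal \<kappa> * emeasure lborel (comb L w \<tau> \<inter> A)"
proof -
  have "emeasure (comb_measure \<kappa> L w \<tau>) A
      = (\<integral>\<^sup>+ x. ennreal \<kappa> * indicator (comb L w \<tau> \<inter> A) x \<partial>lborel)"
    using assms unfolding comb_measure_def
    by (subst emeasure_density) (auto intro!: nn_integral_cong simp: indicator_def)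
  then show ?thesis using assms by (simp add: nn_integral_cmult_indicator)
qed

text \<open>Tooth \<open>i\<close> ends at height at most (i + 1) \<tau> / 8 \<le> 1/8, because
  \<open>w \<le> \<tau>\<close> and i + 1 does not exceed the number of teeth. Both coordinates are
  thus at most 1/8, and the l1 norm bounds the Euclidean one.\<close>

lemma comb_subset_cball:
  assumes "x \<in> comb L w \<tau>" "L \<le> 1" "0 < w" "w \<le> \<tau>" "\<tau> \<le> 1"
  shows "x \<in> cball 0 (1/4)"
proof -
  obtain i where i: "i < teeth \<tau>" "x \<in> tooth L w \<tau> i"
    using assms by (auto simp: comb_def)
  have "real i * \<tau> + w \<le> (real i + 1) * \<tau>" using assms by (simp add: algebra_simps)
  also have "\<dots> \<le> real (teeth \<tau>) * \<tau>"
    using i assms by (intro mult_right_mono) auto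
  also have "\<dots> \<le> 1 / \<tau> * \<tau>"
    using teeth_bounds(1)[of \<tau>] assms by (intro mult_right_mono) auto
  finally have *: "real i * \<tau> + w \<le> 1" using assms by simp
  have "0 \<le> real i * \<tau> / 8" using assms by simp
  with * have "\<bar>x $ 1\<bar> \<le> 1/8" "\<bar>x $ 2\<bar> \<le> 1/8"
    using i(2) \<open>L \<le> 1\<close> by (simp_all add: mem_tooth_iff abs_le_iff)
  then have "norm x \<le> 1/8 + 1/8"
    using norm_le_l1_cart[of x] by (simp add: sum_2)
  then show ?thesis by simp
qed

lemma emeasure_lborel_comb:
  assumes "0 < w" "w \<le> \<tau>" "0 \<le> L"
  shows "emeasure lborel (comb L w \<tau>) = ennreal (real (teeth \<tau>) * (L / 8 * (w / 8)))"
proof -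
  have "disjoint_family_on (tooth L w \<tau>) {..<teeth \<tau>}"
  proof -
    have False if "i < j" "x \<in> tooth L w \<tau> i" "x \<in> tooth L w \<tau> j" for i j x
    proof -
      have "(real i + 1) * \<tau> \<le> real j * \<tau>"
        using that assms by (intro mult_right_mono) auto
      then have "real i * \<tau> + w \<le> real j * \<tau>" using assms by (simp add: algebra_simps)
      then show False using that by (auto simp: mem_tooth_iff)
    qed
    then show ?thesis
      unfolding disjoint_family_on_def by (metis disjoint_iff linorder_neqE_nat)
  qed
  then have "emeasure lborel (comb L w \<tau>) = (\<Sum>i<teeth \<tau>. emeasure lborel (tooth L w \<tau> i))"
    unfolding comb_def by (intro sum_emeasure[symmetric]) auto
  also have "\<dots> = (\<Sum>i<teeth \<tau>. ennreal (L / 8 * (w / 8)))"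
    using assms by (intro sum.cong refl) (simp add: tooth_def emeasure_box_plane add_divide_distrib)
  finally show ?thesis
    using assms by (simp add: ennreal_of_nat_eq_real_of_nat flip: ennreal_mult)
qed

text \<open>Split the minimum m as m^(1-b) m^b, and estimate the first factor by \<open>L\<close>
  and the second by \<open>2 * \<rho>\<close>.\<close>

lemma min_le_powr_interpolation:
  assumes "0 < L" "0 < \<rho>" "0 \<le> b" "b \<le> (1::real)"
  shows "min L (2 * \<rho>) \<le> 2 * L powr (1 - b) * \<rho> powr b"
proof -
  define m where "m = min L (2 * \<rho>)"
  have m: "0 < m" "m \<le> L" "m \<le> 2 * \<rho>" using assms by (auto simp: m_def)
  have "m = m powr (1 - b) * m powr b" using m by (simp flip: powr_add)
  also have "\<dots> \<le> L powr (1 - b) * (2 * \<rho>) powr b"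
    using m assms by (intro mult_mono powr_mono2) auto
  also have "(2 * \<rho>) powr b \<le> 2 * \<rho> powr b"
    using assms powr_mono[of b 1 2] by (simp add: powr_mult)
  finally show ?thesis using assms by (simp add: m_def mult_left_mono mult.assoc)
qed

text \<open>
  Up to scale \<open>w\<close>, the measure has dimension \<open>a\<close> in the direction across the rectangles and \<open>b\<close> along
  them; the spacing \<open>w\<^bsup>\<gamma>\<^esup>\<close> is allowed to be coarser than the \<open>a\<close>-dimensional one.
\<close>

lemma frostman_const_comb_le:
  assumes w: "0 < w" "w \<le> 1" and L: "0 < L" "L \<le> 1"
    and ab: "0 \<le> \<gamma>" "\<gamma> \<le> a" "a \<le> 1" "0 \<le> b" "b \<le> 1" and \<alpha>: "\<alpha> \<le> a + b"
  shows "frostman_const \<alpha> (comb_measure (w powr (a - 1) * L powr (b - 1)) L w (w powr \<gamma>))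
           \<le> ennreal 5"
  unfolding frostman_const_def
proof (rule SUP_least, clarify)
  fix x :: "real^2" and \<rho> :: real
  assume "\<rho> \<in> {0<..1}"
  then have \<rho>: "0 < \<rho>" "\<rho> \<le> 1" by auto
  define \<tau> where "\<tau> = w powr \<gamma>"
  define \<kappa> where "\<kappa> = w powr (a - 1) * L powr (b - 1)"
  \<comment> \<open>An upper bound for the horizontal extent of the part of a tooth inside the
    ball.\<close>
  define m where "m = min L (2 * \<rho>)"
  have \<tau>: "0 < \<tau>" "w \<le> \<tau>"
    using w ab powr_mono'[of \<gamma> 1 w] by (auto simp: \<tau>_def)
  have m: "0 < m" "m \<le> 2 * L powr (1 - b) * \<rho> powr b"
    using L \<rho> ab min_le_powr_interpolation[of L \<rho> b] by (auto simp: m_def)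
  have LL: "L powr (b - 1) * L powr (1 - b) = 1" using L by (simp flip: powr_add)
  \<comment> \<open>It suffices to reach the exponent \<open>a + b\<close>: since
    \<open>\<rho> \<le> 1\<close> and \<open>\<alpha> \<le> a + b\<close>, it gives the bound with
    exponent \<open>\<alpha>\<close>.\<close>
  have "\<exists>M\<ge>0. emeasure lborel (comb L w \<tau> \<inter> cball x \<rho>) \<le> ennreal M \<and> \<kappa> * M \<le> 5 * \<rho> powr (a + b)"
  proof (cases "\<rho> \<le> w")
    \<comment> \<open>For a ball smaller than the tooth width, the gaps between teeth are ignored:
      the part inside lies in one rectangle of size m by 2 \<rho>. Then \<open>a \<le> 1\<close>
      turns \<open>w powr (a - 1)\<close> into \<open>\<rho> powr (a - 1)\<close>.\<close>
    case True
    have "comb L w \<tau> \<inter> cball x \<rho> \<subseteq>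
        cbox (vector [max 0 (x$1 - \<rho>), x$2 - \<rho>]) (vector [min (L/8) (x$1 + \<rho>), x$2 + \<rho>])"
    proof
      fix y assume y: "y \<in> comb L w \<tau> \<inter> cball x \<rho>"
      then have "\<bar>(y - x) $ 1\<bar> \<le> \<rho>" "\<bar>(y - x) $ 2\<bar> \<le> \<rho>"
        using component_le_norm_cart[of "y - x"] by (auto simp: dist_norm norm_minus_commute intro: order_trans)
      with y show "y \<in> cbox (vector [max 0 (x$1 - \<rho>), x$2 - \<rho>]) (vector [min (L/8) (x$1 + \<rho>), x$2 + \<rho>])"
        by (auto simp: comb_def mem_tooth_iff mem_box_cart forall_2)
    qed
    then have "emeasure lborel (comb L w \<tau> \<inter> cball x \<rho>) \<le> emeasure lborel
        (cbox (vector [max 0 (x$1 - \<rho>), x$2 - \<rho>]) (vector [min (L/8) (x$1 + \<rho>), x$2 + \<rho>] :: real^2))"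
      by (intro emeasure_mono) auto
    also have "\<dots> \<le> ennreal (m * (2 * \<rho>))"
      using \<rho> L by (intro emeasure_cbox_plane_le) (auto simp: m_def)
    finally have "emeasure lborel (comb L w \<tau> \<inter> cball x \<rho>) \<le> ennreal (m * (2 * \<rho>))" .
    moreover have "\<kappa> * (m * (2 * \<rho>)) \<le> 5 * \<rho> powr (a + b)"
    proof -
      have "\<kappa> * (m * (2 * \<rho>)) \<le> \<kappa> * ((2 * L powr (1 - b) * \<rho> powr b) * (2 * \<rho>))"
        using m \<rho> by (intro mult_left_mono mult_right_mono) (auto simp: \<kappa>_def)
      also have "\<dots> = (L powr (b - 1) * L powr (1 - b)) * (4 * w powr (a - 1) * (\<rho> powr b * \<rho>))"
        by (simp add: \<kappa>_def algebra_simps)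
      also have "\<dots> = 4 * w powr (a - 1) * \<rho> powr (b + 1)"
        using \<rho> by (simp add: LL powr_add)
      also have "\<dots> \<le> 4 * \<rho> powr (a - 1) * \<rho> powr (b + 1)"
        using \<rho> True ab by (intro mult_right_mono mult_left_mono powr_mono2') auto
      also have "\<dots> = 4 * \<rho> powr (a + b)" by (simp flip: powr_add)
      also have "\<dots> \<le> 5 * \<rho> powr (a + b)" by simp
      finally show ?thesis .
    qed
    ultimately show ?thesis using m \<rho> by (intro exI[of _ "m * (2 * \<rho>)"]) auto
  next
    case False
    \<comment> \<open>The teeth that can meet the ball: 8 times the lower edge of such a tooth lies
      between 8 (x_2 - \<rho>) - w and 8 (x_2 + \<rho>).\<close>
    define H where "H = {i. i < teeth \<tau> \<and> (8 * (x$2 - \<rho>) - w) / \<tau> \<le> real i \<and>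
        real i \<le> (8 * (x$2 - \<rho>) - w) / \<tau> + (16 * \<rho> + w) / \<tau>}"
    define Q where "Q i = cbox (vector [max 0 (x$1 - \<rho>), real i * \<tau> / 8])
        (vector [min (L/8) (x$1 + \<rho>), (real i * \<tau> + w) / 8] :: real^2)" for i :: nat
    have finH: "finite H" by (simp add: H_def)
    have sub: "comb L w \<tau> \<inter> cball x \<rho> \<subseteq> (\<Union>i\<in>H. Q i)"
    proof
      fix y assume y: "y \<in> comb L w \<tau> \<inter> cball x \<rho>"
      then have le: "\<bar>(y - x) $ 1\<bar> \<le> \<rho>" "\<bar>(y - x) $ 2\<bar> \<le> \<rho>"
        using component_le_norm_cart[of "y - x"] by (auto simp: dist_norm norm_minus_commute intro: order_trans)
      obtain i where i: "i < teeth \<tau>" "y \<in> tooth L w \<tau> i" using y by (auto simp: comb_def)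
      have "8 * (x$2 - \<rho>) - w \<le> real i * \<tau>" "real i * \<tau> \<le> (8 * (x$2 - \<rho>) - w) + (16 * \<rho> + w)"
        using le i by (auto simp: mem_tooth_iff)
      then have "i \<in> H"
        using \<tau> i by (simp add: H_def pos_divide_le_eq pos_le_divide_eq flip: add_divide_distrib)
      moreover have "y \<in> Q i"
        using le i by (auto simp: Q_def mem_tooth_iff mem_box_cart forall_2)
      ultimately show "y \<in> (\<Union>i\<in>H. Q i)" by blast
    qed
    have card: "real (card H) \<le> 16 * \<rho> / \<tau> + 2"
    proof -
      have "real (card H) \<le> (16 * \<rho> + w) / \<tau> + 1"
        unfolding H_def using \<rho> w \<tau> by (intro card_nat_interval_le) auto
      \<comment> \<open>Here \<open>w \<le> \<tau>\<close> bounds w/\<tau> by 1.\<close>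
      also have "\<dots> \<le> 16 * \<rho> / \<tau> + 2" using \<tau> by (simp add: add_divide_distrib)
      finally show ?thesis .
    qed
    have "emeasure lborel (comb L w \<tau> \<inter> cball x \<rho>) \<le> emeasure lborel (\<Union>i\<in>H. Q i)"
      using sub finH by (intro emeasure_mono) (auto simp: Q_def)
    also have "\<dots> \<le> (\<Sum>i\<in>H. emeasure lborel (Q i))"
      using finH by (intro emeasure_subadditive_finite) (auto simp: Q_def)
    also have "\<dots> \<le> (\<Sum>i\<in>H. ennreal (m * (w / 8)))"
      unfolding Q_def using \<rho> L w
      by (intro sum_mono emeasure_cbox_plane_le) (auto simp: m_def add_divide_distrib)
    also have "\<dots> = ennreal (real (card H) * (m * (w / 8)))"
      using m w by (simp add: ennreal_of_nat_eq_real_of_nat flip: ennreal_mult)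
    finally have "emeasure lborel (comb L w \<tau> \<inter> cball x \<rho>) \<le> ennreal (real (card H) * (m * (w / 8)))" .
    moreover have "\<kappa> * (real (card H) * (m * (w / 8))) \<le> 5 * \<rho> powr (a + b)"
    proof -
      have "\<kappa> * (real (card H) * (m * (w / 8)))
          \<le> \<kappa> * ((16 * \<rho> / \<tau> + 2) * ((2 * L powr (1 - b) * \<rho> powr b) * (w / 8)))"
        using card m w \<rho> by (intro mult_left_mono mult_mono mult_right_mono) (auto simp: \<kappa>_def)
      also have "\<dots> = (L powr (b - 1) * L powr (1 - b)) * (4 * \<rho> / \<tau> + 1 / 2) *
          (w powr (a - 1) * w) * \<rho> powr b"
        by (simp add: \<kappa>_def field_simps)
      also have "w powr (a - 1) * w = w powr a"
        using w by (simp add: powr_diff)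
      also have "(L powr (b - 1) * L powr (1 - b)) * (4 * \<rho> / \<tau> + 1 / 2) * w powr a * \<rho> powr b
          = (4 * (\<rho> * w powr (a - \<gamma>)) + w powr a / 2) * \<rho> powr b"
        unfolding LL using w by (simp add: \<tau>_def powr_diff field_simps)
      also have "\<dots> \<le> (4 * \<rho> powr a + \<rho> powr a / 2) * \<rho> powr b"
      proof -
        \<comment> \<open>The first estimate uses \<open>w < \<rho>\<close> and
          \<open>\<gamma> \<le> a\<close>, the next one \<open>\<rho> \<le> 1\<close> and
          \<open>\<gamma> \<le> 1\<close>.\<close>
        have "w powr (a - \<gamma>) \<le> \<rho> powr (a - \<gamma>)"
          using w False ab by (intro powr_mono2) auto
        also have "\<dots> \<le> \<rho> powr (a - 1)"
          using \<rho> ab by (intro powr_mono') auto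
        finally have "\<rho> * w powr (a - \<gamma>) \<le> \<rho> * \<rho> powr (a - 1)"
          using \<rho> by (intro mult_left_mono) auto
        also have "\<dots> = \<rho> powr a" using \<rho> by (simp add: powr_diff)
        finally have "\<rho> * w powr (a - \<gamma>) \<le> \<rho> powr a" .
        moreover have "w powr a \<le> \<rho> powr a"
          using w False ab by (intro powr_mono2) auto
        ultimately show ?thesis by (intro mult_right_mono) auto
      qed
      also have "\<dots> = 9 / 2 * \<rho> powr (a + b)" by (simp add: powr_add)
      also have "\<dots> \<le> 5 * \<rho> powr (a + b)" by (intro mult_right_mono) auto
      finally show ?thesis .
    qed
    ultimately show ?thesis
      using m w by (intro exI[of _ "real (card H) * (m * (w / 8))"]) auto
  qed
  then obtain M where M: "0 \<le> M" "emeasure lborel (comb L w \<tau> \<inter> cball x \<rho>) \<le> ennreal M"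
      "\<kappa> * M \<le> 5 * \<rho> powr (a + b)" by blast
  have "\<kappa> * M \<le> 5 * \<rho> powr \<alpha>"
    using M(3) powr_mono'[OF \<alpha>, of \<rho>] \<rho> by linarith
  then have "\<kappa> * M * \<rho> powr (- \<alpha>) \<le> 5 * \<rho> powr \<alpha> * \<rho> powr (- \<alpha>)"
    by (intro mult_right_mono) auto
  then have "\<kappa> * M * \<rho> powr (- \<alpha>) \<le> 5"
    using \<rho> by (simp add: mult.assoc flip: powr_add)
  moreover have "emeasure (comb_measure \<kappa> L w \<tau>) (cball x \<rho>) * ennreal (\<rho> powr (- \<alpha>))
      \<le> ennreal (\<kappa> * M * \<rho> powr (- \<alpha>))"
    using M w L by (auto simp: emeasure_comb_measure ennreal_mult \<kappa>_def intro!: mult_right_mono mult_left_mono)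
  ultimately show "emeasure (comb_measure (w powr (a - 1) * L powr (b - 1)) L w (w powr \<gamma>)) (cball x \<rho>)
      * ennreal (\<rho> powr (- \<alpha>)) \<le> ennreal 5"
    unfolding \<kappa>_def \<tau>_def using ennreal_leI order_trans by blast
qed

text \<open>There are at least 1/(2 \<tau>) teeth of mass w^a L^b / 64 each; this is the origin of
  1/128.\<close>

lemma emeasure_comb_measure_ge:
  assumes w: "0 < w" "w \<le> 1" and L: "0 < L" and \<gamma>: "0 \<le> \<gamma>" "\<gamma> \<le> 1"
  shows "ennreal (1 / 128 * (w powr (a - \<gamma>) * L powr b))
    \<le> emeasure (comb_measure (w powr (a - 1) * L powr (b - 1)) L w (w powr \<gamma>)) (comb L w (w powr \<gamma>))"
proof -
  define \<tau> where "\<tau> = w powr \<gamma>"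
  have \<tau>: "0 < \<tau>" "w \<le> \<tau>" "\<tau> \<le> 1"
    using w \<gamma> powr_mono'[of \<gamma> 1 w] powr_le1[of \<gamma> w] by (auto simp: \<tau>_def)
  have "1 / 128 * (w powr (a - \<gamma>) * L powr b)
      = w powr (a - 1) * L powr (b - 1) * (1 / (2 * \<tau>) * (L / 8 * (w / 8)))"
    using w L by (simp add: \<tau>_def powr_diff field_simps)
  also have "\<dots> \<le> w powr (a - 1) * L powr (b - 1) * (real (teeth \<tau>) * (L / 8 * (w / 8)))"
    using teeth_bounds(2)[of \<tau>] \<tau> w L by (intro mult_left_mono mult_right_mono) auto
  finally show ?thesis
    using \<tau> w L by (simp add: emeasure_comb_measure emeasure_lborel_comb ennreal_leI
        flip: ennreal_mult \<tau>_def)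
qed

subsection \<open>Comparison of exponents\<close>

text \<open>The level set bound is applied first in \<open>r\<close> and then in \<open>x\<close>.
  The centre \<open>u\<close> may vary with \<open>x\<close>, as only the length of the interval
  enters.\<close>

lemma mixed_norm_ge:
  assumes qs: "1 \<le> q" "1 \<le> s" and \<Omega>: "\<Omega> \<in> sets \<nu>" and I: "I \<in> sets borel"
    and E: "E \<in> sets \<nu>" "E \<subseteq> \<Omega>" "0 < n" "ennreal n \<le> emeasure \<nu> E"
    and l: "0 < l" and v: "0 \<le> v"
    and large: "\<And>x. x \<in> E \<Longrightarrow> \<exists>u. {u - l..u + l} \<subseteq> I \<and> (\<forall>r\<in>{u - l..u + l}. v \<le> norm (F x r))"
  shows "ennreal (v * (2 * l) powr enn2real (1 / s) * n powr enn2real (1 / q))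
           \<le> mixed_norm q \<Omega> \<nu> s I F"
  unfolding mixed_norm_def
proof (rule Lp_norm_ge_level[OF qs(1)])
  show "E \<in> sets (restrict_space \<nu> \<Omega>)"
    using E \<Omega> by (simp add: sets_restrict_space_iff)
  show "ennreal n \<le> emeasure (restrict_space \<nu> \<Omega>) E"
    using E \<Omega> by (simp add: emeasure_restrict_space)
  fix x assume "x \<in> E"
  then obtain u where u: "{u - l..u + l} \<subseteq> I" "\<And>r. r \<in> {u - l..u + l} \<Longrightarrow> v \<le> norm (F x r)"
    using large by blast
  show "ennreal (v * (2 * l) powr enn2real (1 / s))
      \<le> Lp_norm s (restrict_space lborel I) (\<lambda>r. ennreal (norm (F x r)))"
  proof (rule Lp_norm_ge_level[OF qs(2), where A = "{u - l..u + l}"])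
    show "{u - l..u + l} \<in> sets (restrict_space lborel I)"
      using u I by (simp add: sets_restrict_space_iff)
    show "ennreal (2 * l) \<le> emeasure (restrict_space lborel I) {u - l..u + l}"
      using u I l by (simp add: emeasure_restrict_space)
  qed (use u l v in \<open>auto intro: ennreal_leI\<close>)
qed (use E v in auto)

text \<open>The operator \<open>T\<close> is left abstract so that circular and annular averages are
  treated together. Positivity of \<open>K\<close> makes \<open>K powr 0\<close> agree with the
  convention for \<open>epowr\<close> when 1/q = 0.\<close>

lemma test_inequality:
  assumes pqs: "1 \<le> p" "1 \<le> q" "1 \<le> s"
    and B: "B \<in> sets borel" and I: "I \<in> sets borel"
    and bound: "\<And>f \<nu>. f \<in> Lp_space p \<Longrightarrow> \<nu> \<in> frostman_class \<alpha> \<Longrightarrow>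
      mixed_norm q B \<nu> s I (T f)
        \<le> ennreal D * epowr (frostman_const \<alpha> \<nu>) (enn2real (1 / q))
            * Lp_norm p lborel (\<lambda>x. ennreal (norm (f x)))"
    and D: "0 \<le> D"
    and F: "F \<in> sets borel" "0 < m" "emeasure lborel F \<le> ennreal m"
    and \<nu>: "sets \<nu> = sets borel" "frostman_const \<alpha> \<nu> \<le> ennreal K" "0 < K"
    and E: "E \<in> sets borel" "E \<subseteq> B" "0 < n" "ennreal n \<le> emeasure \<nu> E"
    and l: "0 < l" and v: "0 \<le> v"
    and large: "\<And>x. x \<in> E \<Longrightarrow> \<exists>u. {u - l..u + l} \<subseteq> I \<and>
      (\<forall>r\<in>{u - l..u + l}. v \<le> norm (T (\<lambda>y. complex_of_real (indicator F y)) x r))"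
  shows "v * (2 * l) powr enn2real (1 / s) * n powr enn2real (1 / q)
    \<le> D * K powr enn2real (1 / q) * m powr enn2real (1 / p)"
proof -
  let ?f = "\<lambda>y. complex_of_real (indicator F y)"
  have "epowr (frostman_const \<alpha> \<nu>) (enn2real (1 / q)) \<le> ennreal (K powr enn2real (1 / q))"
  proof (cases "enn2real (1 / q) = 0")
    case True then show ?thesis using \<open>0 < K\<close> by (simp add: epowr_def)
  next
    case False
    then show ?thesis
      using epowr_mono[OF \<nu>(2), of "enn2real (1 / q)"] \<open>0 < K\<close> by (simp add: epowr_ennreal)
  qed
  have "ennreal (v * (2 * l) powr enn2real (1 / s) * n powr enn2real (1 / q))
      \<le> mixed_norm q B \<nu> s I (T ?f)"
    using B I \<nu> E l v large pqs by (intro mixed_norm_ge) auto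
  also have "\<dots> \<le> ennreal D * epowr (frostman_const \<alpha> \<nu>) (enn2real (1 / q))
      * Lp_norm p lborel (\<lambda>x. ennreal (norm (?f x)))"
    using \<nu> F pqs by (intro bound indicator_in_Lp_space[where m = m])
      (auto simp: frostman_class_def intro: order.strict_trans1)
  also have "\<dots> \<le> ennreal D * ennreal (K powr enn2real (1 / q)) * ennreal (m powr enn2real (1 / p))"
    by (intro mult_mono Lp_norm_indicator_le pqs F \<open>epowr _ _ \<le> _\<close>) auto
  also have "\<dots> = ennreal (D * K powr enn2real (1 / q) * m powr enn2real (1 / p))"
    using D by (simp add: ennreal_mult)
  finally show ?thesis using D by (subst (asm) ennreal_le_iff) auto
qed

definition admissible_bound ::
  "real \<Rightarrow> ennreal \<Rightarrow> ennreal \<Rightarrow> ennreal \<Rightarrow> bool" where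
  "admissible_bound \<alpha> p q s \<longleftrightarrow>
    (\<exists>C\<ge>0. \<forall>f \<in> Lp_space p. \<forall>\<nu> \<in> frostman_class \<alpha>.
        mixed_norm q (cball 0 (1/4)) \<nu> s {1..2} (circ_avg f)
          \<le> ennreal C * epowr (frostman_const \<alpha> \<nu>) (enn2real (1 / q))
              * Lp_norm p lborel (\<lambda>x. ennreal (norm (f x))))
    \<or>
    (\<forall>\<epsilon>>0. \<exists>C\<ge>0. \<forall>\<delta>. 0 < \<delta> \<longrightarrow> \<delta> < 1 \<longrightarrow> (\<forall>f \<in> Lp_space p. \<forall>\<nu> \<in> frostman_class \<alpha>.
        mixed_norm q (cball 0 (1/4)) \<nu> s {1..2} (annulus_avg \<delta> f)
          \<le> ennreal (C * \<delta> powr (- \<epsilon>)) * epowr (frostman_const \<alpha> \<nu>) (enn2real (1 / q))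
              * Lp_norm p lborel (\<lambda>x. ennreal (norm (f x)))))"

text \<open>The thickness is \<delta> = t^k, with \<open>k = 2\<close> when \<open>t\<close> stands
  for the square root of \<delta>. Testing gives t^(e + k/s + b/q) bounded by a multiple of t^(a/p),
  up to a loss t^(-\<epsilon>) for annular averages, and \<open>t\<close> tends to 0.\<close>

lemma admissible_bound_exponents:
  fixes F :: "real \<Rightarrow> (real^2) set" and \<nu> :: "real \<Rightarrow> (real^2) measure"
    and E :: "real \<Rightarrow> (real^2) set"
  assumes adm: "admissible_bound \<alpha> p q s" and pqs: "1 \<le> p" "1 \<le> q" "1 \<le> s"
    and const: "0 < t0" "t0 \<le> 1" "0 < c" "0 < K" "0 < k"
    and F: "\<And>t. 0 < t \<Longrightarrow> t < t0 \<Longrightarrow> F t \<in> sets borel"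
      "\<And>t. 0 < t \<Longrightarrow> t < t0 \<Longrightarrow> emeasure lborel (F t) \<le> ennreal (K * t powr a)"
    and \<nu>: "\<And>t. 0 < t \<Longrightarrow> t < t0 \<Longrightarrow> sets (\<nu> t) = sets borel"
      "\<And>t. 0 < t \<Longrightarrow> t < t0 \<Longrightarrow> frostman_const \<alpha> (\<nu> t) \<le> ennreal K"
    and E: "\<And>t. 0 < t \<Longrightarrow> t < t0 \<Longrightarrow> E t \<in> sets borel"
      "\<And>t. 0 < t \<Longrightarrow> t < t0 \<Longrightarrow> E t \<subseteq> cball 0 (1/4)"
      "\<And>t. 0 < t \<Longrightarrow> t < t0 \<Longrightarrow> ennreal (c * t powr b) \<le> emeasure (\<nu> t) (E t)"
    and large: "\<And>t x. 0 < t \<Longrightarrow> t < t0 \<Longrightarrow> x \<in> E t \<Longrightarrow>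
      \<exists>u. {u - c * t powr k..u + c * t powr k} \<subseteq> {1..2} \<and>
        (\<forall>r\<in>{u - c * t powr k..u + c * t powr k}.
          c * t powr e \<le> norm (circ_avg (\<lambda>y. complex_of_real (indicator (F t) y)) x r) \<and>
          c * t powr e \<le> norm (annulus_avg (t powr k) (\<lambda>y. complex_of_real (indicator (F t) y)) x r))"
  shows "a * enn2real (1 / p) \<le> e + k * enn2real (1 / s) + b * enn2real (1 / q)"
proof -
  define P Q S where "P = enn2real (1 / p)" and "Q = enn2real (1 / q)" and "S = enn2real (1 / s)"
  define M where "M = K powr Q * K powr P"
  define c' where "c' = c * (2 * c) powr S * c powr Q"
  have "0 < c'" using const by (simp add: c'_def)
  have split: "c * t powr e * (2 * (c * t powr k)) powr S * (c * t powr b) powr Q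
      = c' * t powr (e + k * S + b * Q)"
    "K powr Q * (K * t powr a) powr P = M * t powr (a * P)"
    if "0 < t" for t
    using that const by (simp_all add: c'_def M_def powr_mult powr_powr powr_add)
  have test: "c * t powr e * (2 * (c * t powr k)) powr S * (c * t powr b) powr Q
      \<le> D * K powr Q * (K * t powr a) powr P"
    if t: "0 < t" "t < t0" and "0 \<le> D" and T: "T = circ_avg \<or> T = annulus_avg (t powr k)"
      and bd: "\<And>f \<nu>. f \<in> Lp_space p \<Longrightarrow> \<nu> \<in> frostman_class \<alpha> \<Longrightarrow>
        mixed_norm q (cball 0 (1/4)) \<nu> s {1..2} (T f)
          \<le> ennreal D * epowr (frostman_const \<alpha> \<nu>) (enn2real (1 / q))
            * Lp_norm p lborel (\<lambda>x. ennreal (norm (f x)))" for t D T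
    unfolding P_def Q_def S_def
  proof (rule test_inequality[OF pqs _ _ bd, where \<nu> = "\<nu> t" and F = "F t" and E = "E t"])
    fix x assume "x \<in> E t"
    then show "\<exists>u. {u - c * t powr k..u + c * t powr k} \<subseteq> {1..2} \<and>
        (\<forall>r\<in>{u - c * t powr k..u + c * t powr k}.
          c * t powr e \<le> norm (T (\<lambda>y. complex_of_real (indicator (F t) y)) x r))"
      using large[OF t, of x] T by blast
  qed (use t that(3) const F \<nu> E in auto)
  show ?thesis
  proof (cases "\<exists>C\<ge>0. \<forall>f \<in> Lp_space p. \<forall>\<nu> \<in> frostman_class \<alpha>.
        mixed_norm q (cball 0 (1/4)) \<nu> s {1..2} (circ_avg f)
          \<le> ennreal C * epowr (frostman_const \<alpha> \<nu>) (enn2real (1 / q))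
              * Lp_norm p lborel (\<lambda>x. ennreal (norm (f x)))")
    case True
    then obtain C where C: "C \<ge> 0" "\<And>f \<nu>. f \<in> Lp_space p \<Longrightarrow> \<nu> \<in> frostman_class \<alpha> \<Longrightarrow>
        mixed_norm q (cball 0 (1/4)) \<nu> s {1..2} (circ_avg f)
          \<le> ennreal C * epowr (frostman_const \<alpha> \<nu>) (enn2real (1 / q))
              * Lp_norm p lborel (\<lambda>x. ennreal (norm (f x)))" by blast
    have "c' * t powr (e + k * S + b * Q) \<le> (C * M) * t powr (a * P)" if "0 < t" "t < t0" for t
      using test[OF that C(1) disjI1[OF refl] C(2)] split[OF that(1)] by (simp add: mult.assoc)
    then have "a * P \<le> e + k * S + b * Q"
      by (rule powr_exponents_le[OF \<open>0 < c'\<close> const(1)])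
    then show ?thesis by (simp add: P_def Q_def S_def)
  next
    case False
    have "a * P \<le> (e + k * S + b * Q) + \<epsilon>" if "0 < \<epsilon>" for \<epsilon>
    proof -
      \<comment> \<open>The loss is taken as \<open>\<epsilon> / k\<close> because \<delta> = t^k
        turns \<delta>^(-\<epsilon>/k) into t^(-\<epsilon>).\<close>
      have "0 < \<epsilon> / k" using that const by simp
      with False adm obtain C where C: "C \<ge> 0"
        "\<And>\<delta> f \<nu>. 0 < \<delta> \<Longrightarrow> \<delta> < 1 \<Longrightarrow> f \<in> Lp_space p \<Longrightarrow> \<nu> \<in> frostman_class \<alpha> \<Longrightarrow>
          mixed_norm q (cball 0 (1/4)) \<nu> s {1..2} (annulus_avg \<delta> f)
          \<le> ennreal (C * \<delta> powr (- (\<epsilon> / k))) * epowr (frostman_const \<alpha> \<nu>) (enn2real (1 / q))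
              * Lp_norm p lborel (\<lambda>x. ennreal (norm (f x)))"
        unfolding admissible_bound_def by meson
      have "c' * t powr (e + k * S + b * Q) \<le> (C * M) * t powr (a * P - \<epsilon>)"
        if t: "0 < t" "t < t0" for t
      proof -
        have \<delta>: "0 < t powr k" "t powr k < 1"
          using t const powr_less_mono2[of k t 1] by auto
        have "(t powr k) powr (- (\<epsilon> / k)) = t powr (- \<epsilon>)"
          using const by (simp add: powr_powr)
        then have "c' * t powr (e + k * S + b * Q) \<le> C * t powr (- \<epsilon>) * (M * t powr (a * P))"
          using test[OF t _ disjI2[OF refl] C(2)[OF \<delta>]] C(1) split[OF t(1)] by (simp add: mult.assoc)
        then show ?thesis by (simp add: powr_diff powr_minus field_simps)
      qed
      then have "a * P - \<epsilon> \<le> e + k * S + b * Q"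
        by (rule powr_exponents_le[OF \<open>0 < c'\<close> const(1)])
      then show ?thesis by simp
    qed
    then show ?thesis unfolding P_def Q_def S_def by (rule field_le_epsilon)
  qed
qed

subsection \<open>The test functions\<close>

text \<open>Each point of tooth \<open>i\<close> is within t/4 of its corner \<open>z t i\<close>,
  so circles about it of radius near 3/2 lie in the annulus about that corner. The averages are
  bounded below, |F| is at most of order t^(1-\<gamma>), and the mass is at least of order
  t^(\<alpha>-\<gamma>).\<close>

lemma annulus_family_exponents:
  assumes adm: "admissible_bound \<alpha> p q s" and pqs: "1 \<le> p" "1 \<le> q" "1 \<le> s"
    and \<alpha>: "0 < \<alpha>" "\<alpha> \<le> 2" and \<gamma>: "0 \<le> \<gamma>" "\<gamma> \<le> 1" "\<gamma> \<le> \<alpha>"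
  shows "(1 - \<gamma>) * enn2real (1 / p) \<le> enn2real (1 / s) + (\<alpha> - \<gamma>) * enn2real (1 / q)"
proof -
  \<comment> \<open>Splits \<open>\<alpha>\<close> into a vertical dimension \<open>a\<close> and a
    horizontal dimension \<open>b\<close>, both at most 1.\<close>
  define a where "a = min 1 \<alpha>"
  define b where "b = \<alpha> - a"
  define z :: "real \<Rightarrow> nat \<Rightarrow> real^2" where "z t i = vector [0, real i * t powr \<gamma> / 8]" for t i
  define F where "F t = (\<Union>i<teeth (t powr \<gamma>). annulus (3 * t) (z t i) (3/2))" for t
  have ab: "\<gamma> \<le> a" "a \<le> 1" "0 \<le> b" "b \<le> 1" using \<alpha> \<gamma> by (auto simp: a_def b_def)
  have "(1 - \<gamma>) * enn2real (1 / p) \<le> 0 + 1 * enn2real (1 / s) + (\<alpha> - \<gamma>) * enn2real (1 / q)"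
  proof (rule admissible_bound_exponents[OF adm pqs, where F = F and ?t0.0 = "1/8" and c = "1/128"
        and K = 100 and E = "\<lambda>t. comb t t (t powr \<gamma>)"
        and \<nu> = "\<lambda>t. comb_measure (t powr (a - 1) * t powr (b - 1)) t t (t powr \<gamma>)"])
    fix t :: real assume t: "0 < t" "t < 1/8"
    have \<tau>: "0 < t powr \<gamma>" "t \<le> t powr \<gamma>" "t powr \<gamma> \<le> 1"
      using t \<gamma> powr_mono'[of \<gamma> 1 t] powr_le1[of \<gamma> t] by auto
    show "F t \<in> sets borel" by (simp add: F_def)
    show "emeasure lborel (F t) \<le> ennreal (100 * t powr (1 - \<gamma>))"
    proof -
      have "emeasure lborel (F t) \<le> (\<Sum>i<teeth (t powr \<gamma>). emeasure lborel (annulus (3 * t) (z t i) (3/2)))"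
        unfolding F_def by (intro emeasure_subadditive_finite) auto
      \<comment> \<open>The area is 4 pi (3/2) (3 t), and 18 pi < 72 fits below the constant
        100.\<close>
      also have "\<dots> = (\<Sum>i<teeth (t powr \<gamma>). ennreal (18 * pi * t))"
        using t by (intro sum.cong refl, subst emeasure_annulus) auto
      also have "\<dots> = ennreal (real (teeth (t powr \<gamma>)) * (18 * pi * t))"
        using t by (simp add: ennreal_of_nat_eq_real_of_nat flip: ennreal_mult)
      also have "\<dots> \<le> ennreal (1 / t powr \<gamma> * (100 * t))"
        using teeth_bounds(1)[OF \<tau>(1,3)] t pi_less_4 by (intro ennreal_leI mult_mono) auto
      also have "1 / t powr \<gamma> * (100 * t) = 100 * t powr (1 - \<gamma>)"
        using t by (simp add: powr_diff)
      finally show ?thesis .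
    qed
    show "frostman_const \<alpha> (comb_measure (t powr (a - 1) * t powr (b - 1)) t t (t powr \<gamma>)) \<le> ennreal 100"
      using t \<gamma> ab by (intro order_trans[OF frostman_const_comb_le]) (auto simp: b_def)
    show "comb t t (t powr \<gamma>) \<subseteq> cball 0 (1/4)"
      using comb_subset_cball[of _ t t "t powr \<gamma>"] t \<tau> by auto
    have "t powr (a - \<gamma>) * t powr b = t powr (\<alpha> - \<gamma>)"
      by (simp add: b_def flip: powr_add)
    then show "ennreal (1 / 128 * t powr (\<alpha> - \<gamma>))
        \<le> emeasure (comb_measure (t powr (a - 1) * t powr (b - 1)) t t (t powr \<gamma>)) (comb t t (t powr \<gamma>))"
      using emeasure_comb_measure_ge[of t t \<gamma> a b] t \<gamma> by simp
    fix x assume "x \<in> comb t t (t powr \<gamma>)"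
    then obtain i where i: "i < teeth (t powr \<gamma>)" "x \<in> tooth t t (t powr \<gamma>) i"
      by (auto simp: comb_def)
    have "norm (x - z t i) \<le> \<bar>(x - z t i) $ 1\<bar> + \<bar>(x - z t i) $ 2\<bar>"
      using norm_le_l1_cart[of "x - z t i"] by (simp add: sum_2)
    also have "\<dots> \<le> t / 8 + t / 8"
      using i(2) by (intro add_mono) (auto simp: z_def mem_tooth_iff)
    finally have xz: "norm (x - z t i) \<le> t / 4" by simp
    have inF: "y \<in> F t" if "\<bar>norm (y - x) - 3/2\<bar> \<le> 2 * t" for y
    proof -
      have "\<bar>norm (y - z t i) - norm (y - x)\<bar> \<le> norm (x - z t i)"
        using norm_triangle_ineq3[of "y - z t i" "y - x"] by (simp add: algebra_simps)
      then have "y \<in> annulus (3 * t) (z t i) (3/2)"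
        using that xz t unfolding annulus_def by auto
      then show ?thesis using i by (auto simp: F_def)
    qed
    show "\<exists>u. {u - 1 / 128 * t powr 1..u + 1 / 128 * t powr 1} \<subseteq> {1..2} \<and>
        (\<forall>r\<in>{u - 1 / 128 * t powr 1..u + 1 / 128 * t powr 1}.
          1 / 128 * t powr 0 \<le> norm (circ_avg (\<lambda>y. complex_of_real (indicator (F t) y)) x r) \<and>
          1 / 128 * t powr 0 \<le> norm (annulus_avg (t powr 1) (\<lambda>y. complex_of_real (indicator (F t) y)) x r))"
    proof (intro exI[of _ "3/2"] conjI ballI)
      show "{3 / 2 - 1 / 128 * t powr 1..3 / 2 + 1 / 128 * t powr 1} \<subseteq> {1..2}"
        using t by auto
      fix r assume "r \<in> {3 / 2 - 1 / 128 * t powr 1..3 / 2 + 1 / 128 * t powr 1}"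
      then have r: "\<bar>r - 3/2\<bar> \<le> t / 128" using t unfolding abs_le_iff by simp
      \<comment> \<open>The whole circle lies in \<open>F t\<close>; a half circle is used because
        the arc must be shorter than a full turn.\<close>
      have "pi / (2 * pi) \<le> norm (circ_avg (\<lambda>y. complex_of_real (indicator (F t) y)) x r)"
      proof (rule circ_avg_indicator_ge[where \<phi> = 0])
        fix \<theta> :: real
        have "norm (vector [cos \<theta>, sin \<theta>] :: real^2) = 1"
          by (simp add: norm_vec_def L2_set_def sum_2)
        moreover have "\<bar>r\<bar> = r" "\<bar>r - 3/2\<bar> \<le> 2 * t" using r t by linarith+
        ultimately show "x - r *\<^sub>R vector [cos \<theta>, sin \<theta>] \<in> F t"
          by (intro inF) simp
      qed (simp_all add: F_def)
      then show "1 / 128 * t powr 0 \<le> norm (circ_avg (\<lambda>y. complex_of_real (indicator (F t) y)) x r)"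
        using t by simp
      have "1 \<le> r" "t \<le> r" "r \<le> 2" using r t by linarith+
      have "measure lborel (annulus t x r) / (8 * pi * t)
          \<le> norm (annulus_avg t (\<lambda>y. complex_of_real (indicator (F t) y)) x r)"
      proof (rule annulus_avg_indicator_ge)
        show "annulus t x r \<subseteq> F t"
        proof
          fix y assume "y \<in> annulus t x r"
          then have "\<bar>norm (y - x) - r\<bar> \<le> t" by (simp add: annulus_def)
          then have "\<bar>norm (y - x) - 3/2\<bar> \<le> 2 * t" using r t by linarith
          then show "y \<in> F t" by (rule inF)
        qed
      next
        show "t \<le> r" "r \<le> 2" by fact+
      qed (use t in \<open>auto simp: F_def\<close>)
      also have "measure lborel (annulus t x r) / (8 * pi * t) = r / 2"
        using emeasure_annulus[of t r x] \<open>t \<le> r\<close> t by (simp add: measure_def)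
      finally show "1 / 128 * t powr 0
          \<le> norm (annulus_avg (t powr 1) (\<lambda>y. complex_of_real (indicator (F t) y)) x r)"
        using t \<open>1 \<le> r\<close> by simp
    qed
  qed simp_all
  then show ?thesis by simp
qed

section \<open>Knapp rectangles facing a comb of strips\<close>

lemma one_minus_cos_le: "1 - cos \<theta> \<le> \<theta>\<^sup>2 / (2::real)"
proof -
  have "1 - cos \<theta> = 2 * (sin (\<theta> / 2))\<^sup>2" using cos_double_sin[of "\<theta> / 2"] by simp
  also have "\<dots> \<le> 2 * (\<theta> / 2)\<^sup>2"
    using abs_sin_x_le_abs_x[of "\<theta> / 2"] unfolding abs_le_square_iff by (rule mult_left_mono) simp
  finally show ?thesis by (simp add: power2_eq_square)
qed

text \<open>The circle about \<open>x\<close> of radius x_1 + 3/2 touches the line y_1 = -3/2 at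
  height x_2, and stays within order t^2 of it along an arc of length of order t. The radius adapts
  to x_1, so one rectangle serves a strip of unit length. Here \<delta> = t^2, the averages are of
  order t and |F| is at most of order t^(3-\<gamma>).\<close>

lemma knapp_family_exponents:
  assumes adm: "admissible_bound \<alpha> p q s" and pqs: "1 \<le> p" "1 \<le> q" "1 \<le> s"
    and a: "0 \<le> \<gamma>" "\<gamma> \<le> a" "a \<le> 1" "\<alpha> \<le> a + 1"
  shows "(3 - \<gamma>) * enn2real (1 / p) \<le> 1 + 2 * enn2real (1 / s) + (a - \<gamma>) * enn2real (1 / q)"
proof -
  define R :: "real \<Rightarrow> nat \<Rightarrow> (real^2) set" where
    "R t i = cbox (vector [- 3/2 - 2 * t\<^sup>2, real i * t powr \<gamma> / 8 - t])
      (vector [- 3/2 + 2 * t\<^sup>2, real i * t powr \<gamma> / 8 + t])" for t i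
  define F where "F t = (\<Union>i<teeth (t powr \<gamma>). R t i)" for t
  show ?thesis
  \<comment> \<open>The factor \<open>1 powr (1 - 1)\<close> is 1, written so that the density has
    the general form with L = 1 and b = 1.\<close>
  proof (rule admissible_bound_exponents[OF adm pqs, where F = F and ?t0.0 = "1/8" and c = "1/128"
        and K = 100 and E = "\<lambda>t. comb 1 t (t powr \<gamma>)"
        and \<nu> = "\<lambda>t. comb_measure (t powr (a - 1) * 1 powr (1 - 1)) 1 t (t powr \<gamma>)"])
    fix t :: real assume t: "0 < t" "t < 1/8"
    have \<tau>: "0 < t powr \<gamma>" "t \<le> t powr \<gamma>" "t powr \<gamma> \<le> 1"
      using t a powr_mono'[of \<gamma> 1 t] powr_le1[of \<gamma> t] by auto
    have t2: "0 < t\<^sup>2" "t\<^sup>2 < 1/64"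
      using t mult_strict_mono[of t "1/8" t "1/8"] by (auto simp: power2_eq_square)
    show "F t \<in> sets borel" by (simp add: F_def R_def)
    show "emeasure lborel (F t) \<le> ennreal (100 * t powr (3 - \<gamma>))"
    proof -
      have "emeasure lborel (F t) \<le> (\<Sum>i<teeth (t powr \<gamma>). emeasure lborel (R t i))"
        unfolding F_def by (intro emeasure_subadditive_finite) (auto simp: R_def)
      also have "\<dots> \<le> (\<Sum>i<teeth (t powr \<gamma>). ennreal (4 * t\<^sup>2 * (2 * t)))"
        unfolding R_def using t by (intro sum_mono emeasure_cbox_plane_le) auto
      also have "\<dots> = ennreal (real (teeth (t powr \<gamma>)) * (8 * t ^ 3))"
        using t by (simp add: power2_eq_square power3_eq_cube ennreal_of_nat_eq_real_of_nat flip: ennreal_mult)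
      also have "\<dots> \<le> ennreal (1 / t powr \<gamma> * (100 * t ^ 3))"
        using teeth_bounds(1)[OF \<tau>(1,3)] t
        by (intro ennreal_leI mult_mono) auto
      also have "1 / t powr \<gamma> * (100 * t ^ 3) = 100 * t powr (3 - \<gamma>)"
        using t by (simp add: powr_diff)
      finally show ?thesis .
    qed
    show "frostman_const \<alpha> (comb_measure (t powr (a - 1) * 1 powr (1 - 1)) 1 t (t powr \<gamma>)) \<le> ennreal 100"
      using t a by (intro order_trans[OF frostman_const_comb_le]) auto
    show "comb 1 t (t powr \<gamma>) \<subseteq> cball 0 (1/4)"
      using comb_subset_cball[of _ 1 t "t powr \<gamma>"] t \<tau> by auto
    show "ennreal (1 / 128 * t powr (a - \<gamma>))
        \<le> emeasure (comb_measure (t powr (a - 1) * 1 powr (1 - 1)) 1 t (t powr \<gamma>)) (comb 1 t (t powr \<gamma>))"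
      using emeasure_comb_measure_ge[of t 1 \<gamma> a 1] t a by simp
    fix x assume "x \<in> comb 1 t (t powr \<gamma>)"
    then obtain i where i: "i < teeth (t powr \<gamma>)" "x \<in> tooth 1 t (t powr \<gamma>) i"
      by (auto simp: comb_def)
    have x1: "0 < x $ 1" "x $ 1 < 1/8" and x2: "\<bar>x $ 2 - real i * t powr \<gamma> / 8\<bar> \<le> t / 8"
      using i(2) by (auto simp: mem_tooth_iff)
    have inF: "y \<in> F t" if "\<bar>y $ 1 + 3/2\<bar> \<le> 2 * t\<^sup>2" "\<bar>y $ 2 - x $ 2\<bar> \<le> t / 2" for y
    proof -
      have "y \<in> R t i"
        using that x2 t unfolding R_def mem_box_cart forall_2 vector_2 abs_le_iff by linarith
      then show ?thesis using i by (auto simp: F_def)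
    qed
    show "\<exists>u. {u - 1 / 128 * t powr 2..u + 1 / 128 * t powr 2} \<subseteq> {1..2} \<and>
        (\<forall>r\<in>{u - 1 / 128 * t powr 2..u + 1 / 128 * t powr 2}.
          1 / 128 * t powr 1 \<le> norm (circ_avg (\<lambda>y. complex_of_real (indicator (F t) y)) x r) \<and>
          1 / 128 * t powr 1 \<le> norm (annulus_avg (t powr 2) (\<lambda>y. complex_of_real (indicator (F t) y)) x r))"
    proof (intro exI[of _ "x $ 1 + 3/2"] conjI ballI)
      show "{x $ 1 + 3/2 - 1 / 128 * t powr 2..x $ 1 + 3/2 + 1 / 128 * t powr 2} \<subseteq> {1..2}"
        using t t2 x1 by auto
      fix r assume "r \<in> {x $ 1 + 3/2 - 1 / 128 * t powr 2..x $ 1 + 3/2 + 1 / 128 * t powr 2}"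
      then have r: "\<bar>x $ 1 - r + 3/2\<bar> \<le> t\<^sup>2 / 128" using t unfolding abs_le_iff by simp
      then have r12: "1 \<le> r" "r \<le> 2" using x1 t2 by linarith+
      \<comment> \<open>The angle 0 is the leftmost point of the circle; a one-sided arc from there
        avoids crossing the end of the parameter range.\<close>
      have "(t / 4) / (2 * pi) \<le> norm (circ_avg (\<lambda>y. complex_of_real (indicator (F t) y)) x r)"
      proof (rule circ_avg_indicator_ge[where \<phi> = 0])
        fix \<theta> :: real assume "0 \<le> \<theta>" "\<theta> \<le> 0 + t / 4"
        then have \<theta>: "0 \<le> \<theta>" "\<theta> \<le> t / 4" by auto
        have "\<theta>\<^sup>2 \<le> (t / 4)\<^sup>2" using \<theta> by (intro power_mono) auto
        then have "1 - cos \<theta> \<le> t\<^sup>2 / 32"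
          using one_minus_cos_le[of \<theta>] by (simp add: power2_eq_square)
        then have "r * (1 - cos \<theta>) \<le> 2 * (t\<^sup>2 / 32)" "0 \<le> r * (1 - cos \<theta>)"
          using r12 by (intro mult_mono, auto)
        then have c: "\<bar>r * (1 - cos \<theta>)\<bar> \<le> t\<^sup>2 / 16" by simp
        have "\<bar>sin \<theta>\<bar> \<le> t / 4" using abs_sin_x_le_abs_x[of \<theta>] \<theta> by simp
        then have "\<bar>r\<bar> * \<bar>sin \<theta>\<bar> \<le> 2 * (t / 4)" using r12 by (intro mult_mono) auto
        then have s: "\<bar>r * sin \<theta>\<bar> \<le> t / 2" by (simp add: abs_mult)
        have "x $ 1 - r * cos \<theta> + 3/2 = (x $ 1 - r + 3/2) + r * (1 - cos \<theta>)"
          by (simp add: algebra_simps)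
        then have "\<bar>x $ 1 - r * cos \<theta> + 3/2\<bar> \<le> 2 * t\<^sup>2"
          using r c t2 by linarith
        then show "x - r *\<^sub>R vector [cos \<theta>, sin \<theta>] \<in> F t"
          using s t2 by (intro inF) auto
      qed (use t pi_gt3 in \<open>auto simp: F_def R_def\<close>)
      moreover have "1 / 128 * t \<le> (t / 4) / (2 * pi)"
        using t pi_less_4 by (simp add: field_simps)
      ultimately show "1 / 128 * t powr 1 \<le> norm (circ_avg (\<lambda>y. complex_of_real (indicator (F t) y)) x r)"
        using t by simp
      \<comment> \<open>A rectangle of size t^2 by t/2 centred at the leftmost point of the circle
        of radius \<open>r\<close>.\<close>
      define G :: "(real^2) set" where "G = cbox (vector [x $ 1 - r - t\<^sup>2 / 2, x $ 2 - t / 4])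
          (vector [x $ 1 - r + t\<^sup>2 / 2, x $ 2 + t / 4])"
      have "measure lborel G / (8 * pi * t\<^sup>2)
          \<le> norm (annulus_avg (t\<^sup>2) (\<lambda>y. complex_of_real (indicator (F t) y)) x r)"
      proof (rule annulus_avg_indicator_ge)
        have G: "\<bar>y $ 1 - x $ 1 + r\<bar> \<le> t\<^sup>2 / 2" "\<bar>y $ 2 - x $ 2\<bar> \<le> t / 4" if "y \<in> G" for y
          using that unfolding G_def mem_box_cart forall_2 vector_2 abs_le_iff by linarith+
        show "G \<subseteq> F t"
        proof
          fix y assume "y \<in> G"
          note G[OF this]
          then show "y \<in> F t" using r t t2 by (intro inF) linarith+
        qed
        show "G \<subseteq> annulus (t\<^sup>2) x r"
        proof
          fix y assume "y \<in> G"
          note y = G[OF this]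
          \<comment> \<open>The distance from \<open>x\<close> to \<open>y\<close> exceeds its
            horizontal part \<open>h\<close> by at most t^2/2, since d^2 \<le> t^2/16 is below t^2
            h. Together with |h - r| \<le> t^2/2 this gives the thickness t^2.\<close>
          define h where "h = x $ 1 - y $ 1"
          define d where "d = y $ 2 - x $ 2"
          have h: "\<bar>h - r\<bar> \<le> t\<^sup>2 / 2" using y unfolding h_def by linarith
          then have h12: "1/2 \<le> h" using r12 t2 by linarith
          have "d\<^sup>2 \<le> (t / 4)\<^sup>2" using y by (simp add: d_def flip: abs_le_square_iff)
          then have d: "d\<^sup>2 \<le> t\<^sup>2 / 16" by (simp add: power2_eq_square)
          have nrm: "norm (y - x) = sqrt (h\<^sup>2 + d\<^sup>2)"
            by (simp add: norm_vec_def L2_set_def sum_2 h_def d_def power2_commute)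
          have "h \<le> norm (y - x)"
            unfolding nrm by (rule real_le_rsqrt) simp
          moreover have "norm (y - x) \<le> h + t\<^sup>2 / 2"
          proof -
            have "t\<^sup>2 * (1/2) \<le> t\<^sup>2 * h" using h12 t2 by (intro mult_left_mono) auto
            moreover have "(h + t\<^sup>2 / 2)\<^sup>2 = h\<^sup>2 + t\<^sup>2 * h + (t\<^sup>2 / 2)\<^sup>2"
              by (simp add: power2_sum)
            ultimately have "h\<^sup>2 + d\<^sup>2 \<le> (h + t\<^sup>2 / 2)\<^sup>2"
              using d t2 zero_le_power2[of "t\<^sup>2 / 2"] by linarith
            then show ?thesis
              unfolding nrm using h12 t2 by (intro real_le_lsqrt) auto
          qed
          ultimately show "y \<in> annulus (t\<^sup>2) x r"
            using h unfolding annulus_def mem_Collect_eq by linarith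
        qed
      qed (use t t2 r12 in \<open>auto simp: F_def R_def G_def\<close>)
      also have "measure lborel G = t\<^sup>2 * (t / 2)"
        unfolding G_def using t t2 by (subst measure_cbox_plane) auto
      finally have "t / (16 * pi) \<le> norm (annulus_avg (t\<^sup>2) (\<lambda>y. complex_of_real (indicator (F t) y)) x r)"
        using t by (simp add: field_simps)
      moreover have "1 / 128 * t \<le> t / (16 * pi)"
        using t pi_less_4 by (simp add: field_simps)
      ultimately show "1 / 128 * t powr 1
          \<le> norm (annulus_avg (t powr 2) (\<lambda>y. complex_of_real (indicator (F t) y)) x r)"
        using t by simp
    qed
  qed simp_all
qed

section \<open>A small ball and centres in a fixed square\<close>

lemma abs_cos_diff_le: "\<bar>cos x - cos y\<bar> \<le> \<bar>x - y\<bar>" for x y :: real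
proof -
  have "\<bar>cos x - cos y\<bar> = 2 * (\<bar>sin ((x + y) / 2)\<bar> * \<bar>sin ((y - x) / 2)\<bar>)"
    by (simp add: cos_diff_cos abs_mult)
  also have "\<dots> \<le> 2 * (1 * \<bar>(y - x) / 2\<bar>)"
    by (intro mult_left_mono mult_mono abs_sin_x_le_abs_x) auto
  finally show ?thesis by (simp add: abs_minus_commute)
qed

lemma abs_sin_diff_le: "\<bar>sin x - sin y\<bar> \<le> \<bar>x - y\<bar>" for x y :: real
  using abs_cos_diff_le[of "pi/2 - x" "pi/2 - y"] by (simp add: cos_sin_eq abs_minus_commute)

text \<open>For every centre \<open>x\<close> some circle passes through the centre \<open>z\<close>
  of the ball, and an arc of angle t of each nearby circle stays in the ball. The averages are of
  order t, |F| is of order t^2, and the mass is independent of t; the powers of 1 again match the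
  general form of the density.\<close>

lemma ball_exponents:
  assumes adm: "admissible_bound \<alpha> p q s" and pqs: "1 \<le> p" "1 \<le> q" "1 \<le> s"
    and \<alpha>: "0 < \<alpha>" "\<alpha> \<le> 2"
  shows "2 * enn2real (1 / p) \<le> 1 + enn2real (1 / s)"
proof -
  define z :: "real^2" where "z = vector [- 3/2, 0]"
  define F where "F t = cball z (5 * t)" for t
  have "2 * enn2real (1 / p) \<le> 1 + 1 * enn2real (1 / s) + 0 * enn2real (1 / q)"
  proof (rule admissible_bound_exponents[OF adm pqs, where F = F and ?t0.0 = "1/8" and c = "1/128"
        and K = 100 and E = "\<lambda>t. comb 1 1 (1 powr 0)"
        and \<nu> = "\<lambda>t. comb_measure (1 powr (\<alpha> / 2 - 1) * 1 powr (\<alpha> / 2 - 1)) 1 1 (1 powr 0)"])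
    fix t :: real assume t: "0 < t" "t < 1/8"
    show "F t \<in> sets borel" by (simp add: F_def)
    show "emeasure lborel (F t) \<le> ennreal (100 * t powr 2)"
      using t pi_less_4 by (auto simp: F_def emeasure_cball unit_ball_vol_2 power_mult_distrib intro!: ennreal_leI)
    show "frostman_const \<alpha> (comb_measure (1 powr (\<alpha> / 2 - 1) * 1 powr (\<alpha> / 2 - 1)) 1 1 (1 powr 0)) \<le> ennreal 100"
      using \<alpha> by (intro order_trans[OF frostman_const_comb_le]) auto
    show "comb 1 1 (1 powr 0) \<subseteq> cball 0 (1/4)"
      using comb_subset_cball[of _ 1 1 "1 powr 0"] by auto
    show "ennreal (1 / 128 * t powr 0)
        \<le> emeasure (comb_measure (1 powr (\<alpha> / 2 - 1) * 1 powr (\<alpha> / 2 - 1)) 1 1 (1 powr 0)) (comb 1 1 (1 powr 0))"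
      using emeasure_comb_measure_ge[of 1 1 0 "\<alpha> / 2" "\<alpha> / 2"] t by simp
    fix x :: "real^2" assume x: "x \<in> comb 1 1 (1 powr 0)"
    have nx: "norm x \<le> 1/4" using comb_subset_cball[OF x] by simp
    obtain i where "x \<in> tooth 1 1 (1 powr 0) i" using x by (auto simp: comb_def)
    then have x12: "0 < x $ 1" "0 < x $ 2"
      unfolding mem_tooth_iff by (auto intro: order.strict_trans1[of 0 "real i / 8"])
    define \<rho> where "\<rho> = norm (x - z)"
    have "norm z = 3/2" by (simp add: z_def norm_vec_def L2_set_def sum_2)
    then have \<rho>: "5/4 \<le> \<rho>" "\<rho> \<le> 7/4"
      using nx norm_triangle_ineq4[of x z] norm_triangle_ineq2[of z x]
      by (auto simp: \<rho>_def norm_minus_commute)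
    have sq: "(x $ 1 + 3/2)\<^sup>2 + (x $ 2)\<^sup>2 = \<rho>\<^sup>2"
      by (simp add: \<rho>_def z_def norm_vec_def L2_set_def sum_2)
    \<comment> \<open>Both coordinates of \<open>x - z\<close> are positive, so its polar angle is
      at most pi/2 and the arc from \<open>\<phi>\<close> to \<open>\<phi> + t\<close> does not wrap
      around.\<close>
    have "\<exists>\<phi>\<ge>0. \<phi> \<le> pi/2 \<and> (x $ 1 + 3/2) / \<rho> = cos \<phi> \<and> x $ 2 / \<rho> = sin \<phi>"
    proof (rule sincos_total_pi_half)
      show "((x $ 1 + 3/2) / \<rho>)\<^sup>2 + (x $ 2 / \<rho>)\<^sup>2 = 1"
        using sq \<rho> by (simp add: power_divide flip: add_divide_distrib)
    qed (use x12 \<rho> in auto)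
    then obtain \<phi> where \<phi>: "0 \<le> \<phi>" "\<phi> \<le> pi/2" "x $ 1 + 3/2 = \<rho> * cos \<phi>" "x $ 2 = \<rho> * sin \<phi>"
      using \<rho> by (auto simp: field_simps)
    show "\<exists>u. {u - 1 / 128 * t powr 1..u + 1 / 128 * t powr 1} \<subseteq> {1..2} \<and>
        (\<forall>r\<in>{u - 1 / 128 * t powr 1..u + 1 / 128 * t powr 1}.
          1 / 128 * t powr 1 \<le> norm (circ_avg (\<lambda>y. complex_of_real (indicator (F t) y)) x r) \<and>
          1 / 128 * t powr 1 \<le> norm (annulus_avg (t powr 1) (\<lambda>y. complex_of_real (indicator (F t) y)) x r))"
    proof (intro exI[of _ \<rho>] conjI ballI)
      show "{\<rho> - 1 / 128 * t powr 1..\<rho> + 1 / 128 * t powr 1} \<subseteq> {1..2}"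
        using t \<rho> by auto
      fix r assume "r \<in> {\<rho> - 1 / 128 * t powr 1..\<rho> + 1 / 128 * t powr 1}"
      then have r: "\<bar>\<rho> - r\<bar> \<le> t / 128" using t unfolding abs_le_iff by simp
      then have r12: "1 \<le> r" "r \<le> 2" using \<rho> t by linarith+
      have "t / (2 * pi) \<le> norm (circ_avg (\<lambda>y. complex_of_real (indicator (F t) y)) x r)"
      proof (rule circ_avg_indicator_ge)
        fix \<theta> :: real assume "\<phi> \<le> \<theta>" "\<theta> \<le> \<phi> + t"
        then have \<theta>: "\<bar>\<phi> - \<theta>\<bar> \<le> t" by auto
        define e :: "real \<Rightarrow> real^2" where "e \<theta> = vector [cos \<theta>, sin \<theta>]" for \<theta>
        \<comment> \<open>Subtracts x - \<rho> e(\<phi>) = z, separating the radial from the angular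
          error. Their sum is at most t + 2 (t + t), which explains the radius 5 t.\<close>
        have "x - r *\<^sub>R e \<theta> - z = (\<rho> - r) *\<^sub>R e \<phi> + r *\<^sub>R (e \<phi> - e \<theta>)"
          using \<phi>(3,4) by (simp add: vec_eq_iff forall_2 e_def z_def algebra_simps)
        then have "norm (x - r *\<^sub>R e \<theta> - z) \<le> \<bar>\<rho> - r\<bar> * norm (e \<phi>) + \<bar>r\<bar> * norm (e \<phi> - e \<theta>)"
          by (metis norm_scaleR norm_triangle_ineq)
        also have "norm (e \<phi>) = 1" by (simp add: e_def norm_vec_def L2_set_def sum_2)
        also have "norm (e \<phi> - e \<theta>) \<le> \<bar>cos \<phi> - cos \<theta>\<bar> + \<bar>sin \<phi> - sin \<theta>\<bar>"
          using norm_le_l1_cart[of "e \<phi> - e \<theta>"] by (simp add: sum_2 e_def)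
        also have "\<dots> \<le> t + t"
          using \<theta> abs_cos_diff_le[of \<phi> \<theta>] abs_sin_diff_le[of \<phi> \<theta>] by linarith
        also have "\<bar>\<rho> - r\<bar> * 1 + \<bar>r\<bar> * (t + t) \<le> t + 2 * (t + t)"
          using r r12 t by (intro add_mono mult_mono) auto
        finally show "x - r *\<^sub>R vector [cos \<theta>, sin \<theta>] \<in> F t"
          by (simp add: F_def e_def dist_norm norm_minus_commute mult_left_mono)
      qed (use \<phi> t pi_gt3 in \<open>auto simp: F_def\<close>)
      moreover have "1 / 128 * t \<le> t / (2 * pi)"
        using t pi_less_4 by (simp add: field_simps)
      ultimately show "1 / 128 * t powr 1 \<le> norm (circ_avg (\<lambda>y. complex_of_real (indicator (F t) y)) x r)"
        using t by simp
      have "measure lborel (cball z (t / 2)) / (8 * pi * t)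
          \<le> norm (annulus_avg t (\<lambda>y. complex_of_real (indicator (F t) y)) x r)"
      proof (rule annulus_avg_indicator_ge)
        show "cball z (t / 2) \<subseteq> annulus t x r"
        proof
          fix y assume "y \<in> cball z (t / 2)"
          then have "norm (y - z) \<le> t / 2" by (simp add: dist_norm norm_minus_commute)
          moreover have "\<bar>norm (y - x) - \<rho>\<bar> \<le> norm (y - z)"
            using norm_triangle_ineq3[of "y - x" "z - x"]
            by (simp add: \<rho>_def norm_minus_commute)
          ultimately have "\<bar>norm (y - x) - r\<bar> \<le> t" using r t by linarith
          then show "y \<in> annulus t x r" by (simp add: annulus_def)
        qed
      qed (use t r12 in \<open>auto simp: F_def\<close>)
      also have "measure lborel (cball z (t / 2)) = pi * (t / 2)\<^sup>2"
        using t by (simp add: content_cball unit_ball_vol_2)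
      finally show "1 / 128 * t powr 1
          \<le> norm (annulus_avg (t powr 1) (\<lambda>y. complex_of_real (indicator (F t) y)) x r)"
        using t by (simp add: power2_eq_square field_simps)
    qed
  qed simp_all
  then show ?thesis by simp
qed

section \<open>The five conditions from choices of the parameters\<close>

theorem proposition1p3:
  fixes \<alpha> :: real and p q s :: ennreal and B :: "(real^2) set" and I :: "real set"
  assumes B: "B = cball 0 (1/4)" and I: "I = {1..2}"
    and \<alpha>: "0 < \<alpha>" "\<alpha> \<le> 2"
    and pqs: "1 \<le> p" "1 \<le> q" "1 \<le> s"
    and bound:
      "(\<exists>C\<ge>0. \<forall>f \<in> Lp_space p. \<forall>\<nu> \<in> frostman_class \<alpha>.
          mixed_norm q B \<nu> s I (circ_avg f)
            \<le> ennreal C * epowr (frostman_const \<alpha> \<nu>) (enn2real (1 / q))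
                * Lp_norm p lborel (\<lambda>x. ennreal (norm (f x))))
       \<or>
       (\<forall>\<epsilon>>0. \<exists>C\<ge>0. \<forall>\<delta>. 0 < \<delta> \<longrightarrow> \<delta> < 1 \<longrightarrow> (\<forall>f \<in> Lp_space p. \<forall>\<nu> \<in> frostman_class \<alpha>.
          mixed_norm q B \<nu> s I (annulus_avg \<delta> f)
            \<le> ennreal (C * \<delta> powr (- \<epsilon>)) * epowr (frostman_const \<alpha> \<nu>) (enn2real (1 / q))
                * Lp_norm p lborel (\<lambda>x. ennreal (norm (f x)))))"
  shows "enn2real (1 / s) + \<alpha> * enn2real (1 / q) \<ge> enn2real (1 / p)
    \<and> 1 + 2 * enn2real (1 / s) + max 0 (\<alpha> - 1) * enn2real (1 / q) \<ge> 3 * enn2real (1 / p)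
    \<and> 1 + enn2real (1 / s) \<ge> 2 * enn2real (1 / p)
    \<and> (1 \<le> \<alpha> \<longrightarrow> 1 + 2 * enn2real (1 / s) \<ge> (4 - \<alpha>) * enn2real (1 / p))
    \<and> (\<alpha> \<le> 1 \<longrightarrow> enn2real (1 / s) \<ge> (1 - \<alpha>) * enn2real (1 / p))"
proof -
  define P Q S where "P = enn2real (1 / p)" and "Q = enn2real (1 / q)" and "S = enn2real (1 / s)"
  have adm: "admissible_bound \<alpha> p q s"
    using bound unfolding B I admissible_bound_def .
  note annuli = annulus_family_exponents[OF adm pqs \<alpha>, folded P_def Q_def S_def]
  note knapp = knapp_family_exponents[OF adm pqs, folded P_def Q_def S_def]
  \<comment> \<open>For \<gamma> = 0 there is one small square and one annulus.\<close>
  have "P \<le> S + \<alpha> * Q"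
    using annuli[of 0] \<alpha> by simp
  \<comment> \<open>The value of \<open>a\<close> is the least nonnegative one with
    \<open>\<alpha> \<le> a + 1\<close>; \<gamma> = 0 leaves one strip.\<close>
  moreover have "3 * P \<le> 1 + 2 * S + max 0 (\<alpha> - 1) * Q"
    using knapp[of 0 "max 0 (\<alpha> - 1)"] \<alpha> by simp
  moreover have "2 * P \<le> 1 + S"
    using ball_exponents[OF adm pqs \<alpha>] by (simp add: P_def S_def)
  \<comment> \<open>Taking \<gamma> = a = \<alpha> - 1 keeps the mass of order 1, so that
    \<open>Q\<close> disappears.\<close>
  moreover have "(4 - \<alpha>) * P \<le> 1 + 2 * S" if "1 \<le> \<alpha>"
    using knapp[of "\<alpha> - 1" "\<alpha> - 1"] \<alpha> that by (simp add: algebra_simps)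
  \<comment> \<open>Likewise \<gamma> = \<alpha> removes \<open>Q\<close> in the annulus
    family.\<close>
  moreover have "(1 - \<alpha>) * P \<le> S" if "\<alpha> \<le> 1"
    using annuli[of \<alpha>] \<alpha> that by simp
  ultimately show ?thesis
    by (simp add: P_def Q_def S_def)
qed

end
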